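(* Let $\alpha\in(0,1)$, $p\in(0,1]$, and $\tau=\frac{\sqrt{\alpha(1-\alpha)}}{L}\gamma$ with $\gamma\in(0,1)$. For the sequences generated by FoRB with variance reduction (described in the context), let $$\Phi_{k+1}(\mathbf z)=\alpha\|\mathbf z_{k+1}-\mathbf z\|^2+\frac{1-\alpha}{p}\|\mathbf w_{k+1}-\mathbf z\|^2+2\tau\langle F(\mathbf z_{k+1})-F(\mathbf w_k),\mathbf z-\mathbf z_{k+1}\rangle+(1-\alpha)\|\mathbf z_{k+1}-\mathbf w_k\|^2 ,\qquad k\ge 0.$$ Then for any $\mathbf z_*\in\mathsf{Sol}$ and every $k\ge1$, $\Phi_k(\mathbf z_* )$ is nonnegative and $$\mathbb E_k\left[\Phi_{k+1}(\mathbf z_* )\right]\le\Phi_k(\mathbf z_* ).$$ Moreover, if $F_\xi$ is continuous for all $\xi$, then $(\mathbf z_k)$ converges almost surely to some $\mathbf z_*\in\mathsf{Sol}$.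
   Context: Let $\mathcal Z$ be a finite-dimensional vector space with Euclidean inner product $\langle\cdot,\cdot\rangle$ and norm $\|\cdot\|$. Monotone inclusion problem: find $\mathbf z_*\in\mathcal Z$ such that $0\in(F+G)(\mathbf z_* )$. Assumptions: the solution set $\mathsf{Sol}=(F+G)^{-1}(0)$ is nonempty; the operators $G:\mathcal Z\rightrightarrows\mathcal Z$ and $F:\mathcal Z\to\mathcal Z$ are maximally monotone; $F$ has a stochastic oracle $F_\xi$ ($\xi$ with distribution $Q$) that is unbiased, $F(\mathbf z)=\mathbb E_\xi[F_\xi(\mathbf z)]$, and $L$-Lipschitz in mean ($L>0$): $\mathbb E_\xi\|F_\xi(\mathbf u)-F_\xi(\mathbf v)\|^2\le L^2\|\mathbf u-\mathbf v\|^2$ for all $\mathbf u,\mathbf v\in\mathcal Z$. The resolvent is $J_G=(I+G)^{-1}$. FoRB with variance reduction: given deterministic $\mathbf z_0=\mathbf w_0=\mathbf z_1=\mathbf w_1$, for $k=1,2,\dots$: $\bar{\mathbf z}_k=\alpha\mathbf z_k+(1-\alpha)\mathbf w_k$; draw $\xi_k\sim Q$ (independently of the past); $\mathbf z_{k+1}=J_{\tau G}\bigl(\bar{\mathbf z}_k-\tau F(\mathbf w_k)-\tau(F_{\xi_k}(\mathbf z_k)-F_{\xi_k}(\mathbf w_{k-1}))\bigr)$; $\mathbf w_{k+1}=\mathbf z_{k+1}$ with probability $p$ and $\mathbf w_{k+1}=\mathbf w_k$ with probability $1-p$ (independently of everything else). $\mathbb E_k[\cdot]$ denotes the conditional expectation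 given all randomness up to and including the choice of $\mathbf w_k$ and before drawing $\xi_k$, i.e. given $\sigma(\xi_1,\dots,\xi_{k-1},\mathbf w_1,\dots,\mathbf w_k)$. *)

theory Defs
  imports "HOL-Probability.Probability"
begin

text \<open>Set-valued operators \<open>A : \<Z> \<rightrightarrows> \<Z>\<close> are functions \<open>'z \<Rightarrow> 'z set\<close>; a single-valued
  operator \<open>F\<close> is embedded as \<open>\<lambda>x. {F x}\<close>.\<close>

definition monotone_op :: "('z::real_inner \<Rightarrow> 'z set) \<Rightarrow> bool" where
  "monotone_op A \<longleftrightarrow> (\<forall>x y. \<forall>u\<in>A x. \<forall>v\<in>A y. 0 \<le> (u - v) \<bullet> (x - y))"

definition maximally_monotone :: "('z::real_inner \<Rightarrow> 'z set) \<Rightarrow> bool" where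
  "maximally_monotone A \<longleftrightarrow>
     monotone_op A \<and> (\<forall>B. monotone_op B \<and> (\<forall>x. A x \<subseteq> B x) \<longrightarrow> B = A)"

definition op_scale :: "real \<Rightarrow> ('z::real_vector \<Rightarrow> 'z set) \<Rightarrow> 'z \<Rightarrow> 'z set" where
  "op_scale t A x = (\<lambda>u. t *\<^sub>R u) ` A x"

text \<open>\<open>(I + A)\<inverse>\<close> as a set-valued inverse, so that no choice is involved. If \<open>A\<close> is monotone,
  \<open>resolvent A u\<close> has at most one element; if \<open>A\<close> is maximally monotone, exactly one (Minty), and
  \<open>x \<in> resolvent A u\<close> is then the equation \<open>x = J\<^sub>A u\<close>.\<close>

definition resolvent :: "('z::real_vector \<Rightarrow> 'z set) \<Rightarrow> 'z \<Rightarrow> 'z set" where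
  "resolvent A u = {x. u \<in> (\<lambda>v. x + v) ` A x}"

definition Sol :: "('z::real_vector \<Rightarrow> 'z) \<Rightarrow> ('z \<Rightarrow> 'z set) \<Rightarrow> 'z set" where
  "Sol F G = {z. 0 \<in> (\<lambda>v. F z + v) ` G z}"

text \<open>\<open>Fo s u\<close> is \<open>F\<^sub>\<xi>(u)\<close> at \<open>\<xi> = s\<close>. Joint measurability makes \<open>F\<^sub>\<xi>\<close>, evaluated at a random point,
  a random variable. The second moment is a nonnegative Lebesgue integral, so the Lipschitz bound
  includes that it is finite.\<close>

definition stochastic_oracle ::
  "'x measure \<Rightarrow> ('x \<Rightarrow> 'z::euclidean_space \<Rightarrow> 'z) \<Rightarrow> ('z \<Rightarrow> 'z) \<Rightarrow> real \<Rightarrow> bool" where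
  "stochastic_oracle Q Fo F L \<longleftrightarrow>
     prob_space Q \<and>
     (\<lambda>(s, u). Fo s u) \<in> borel_measurable (Q \<Otimes>\<^sub>M borel) \<and>
     (\<forall>u. has_bochner_integral Q (\<lambda>s. Fo s u) (F u)) \<and>
     (\<forall>u v. (\<integral>\<^sup>+ s. ennreal ((norm (Fo s u - Fo s v))\<^sup>2) \<partial>Q) \<le> ennreal (L\<^sup>2 * (norm (u - v))\<^sup>2))"

text \<open>The randomness of the method: samples \<open>\<xi>\<^sub>k \<sim> Q\<close> and coins \<open>c\<^sub>k\<close> with success probability \<open>p\<close>,
  for \<open>k \<ge> 1\<close>, all mutually independent. As \<open>indep_vars\<close> needs a common value type, this is
  expressed by independence over \<open>k\<close> of the pairs \<open>(\<xi>\<^sub>k, c\<^sub>k)\<close>, each pair having the product law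
  of \<open>Q\<close> and the Bernoulli distribution.\<close>

definition independent_draws ::
  "'w measure \<Rightarrow> 'x measure \<Rightarrow> real \<Rightarrow> (nat \<Rightarrow> 'w \<Rightarrow> 'x) \<Rightarrow> (nat \<Rightarrow> 'w \<Rightarrow> bool) \<Rightarrow> bool" where
  "independent_draws M Q p \<xi> c \<longleftrightarrow>
     prob_space.indep_vars M (\<lambda>_. Q \<Otimes>\<^sub>M count_space UNIV) (\<lambda>k \<omega>. (\<xi> k \<omega>, c k \<omega>)) {1..} \<and>
     (\<forall>k\<ge>1. distr M (Q \<Otimes>\<^sub>M count_space UNIV) (\<lambda>\<omega>. (\<xi> k \<omega>, c k \<omega>))
              = Q \<Otimes>\<^sub>M measure_pmf (bernoulli_pmf p))"

definition forb_vr ::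
  "'w measure \<Rightarrow> ('z::euclidean_space \<Rightarrow> 'z) \<Rightarrow> ('z \<Rightarrow> 'z set) \<Rightarrow> ('x \<Rightarrow> 'z \<Rightarrow> 'z) \<Rightarrow>
   real \<Rightarrow> real \<Rightarrow> 'z \<Rightarrow> (nat \<Rightarrow> 'w \<Rightarrow> 'x) \<Rightarrow> (nat \<Rightarrow> 'w \<Rightarrow> bool) \<Rightarrow>
   (nat \<Rightarrow> 'w \<Rightarrow> 'z) \<Rightarrow> (nat \<Rightarrow> 'w \<Rightarrow> 'z) \<Rightarrow> bool" where
  "forb_vr M F G Fo \<alpha> \<tau> z\<^sub>0 \<xi> c z w \<longleftrightarrow>
     (\<forall>\<omega>\<in>space M. z 0 \<omega> = z\<^sub>0 \<and> w 0 \<omega> = z\<^sub>0 \<and> z 1 \<omega> = z\<^sub>0 \<and> w 1 \<omega> = z\<^sub>0) \<and>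
     (\<forall>k\<ge>1. \<forall>\<omega>\<in>space M.
        (let z_bar = \<alpha> *\<^sub>R z k \<omega> + (1 - \<alpha>) *\<^sub>R w k \<omega> in
         z (k + 1) \<omega> \<in> resolvent (op_scale \<tau> G)
           (z_bar - \<tau> *\<^sub>R F (w k \<omega>) - \<tau> *\<^sub>R (Fo (\<xi> k \<omega>) (z k \<omega>) - Fo (\<xi> k \<omega>) (w (k - 1) \<omega>)))) \<and>
        w (k + 1) \<omega> = (if c k \<omega> then z (k + 1) \<omega> else w k \<omega>))"

definition past ::
  "'w measure \<Rightarrow> 'x measure \<Rightarrow> (nat \<Rightarrow> 'w \<Rightarrow> 'x) \<Rightarrow> (nat \<Rightarrow> 'w \<Rightarrow> 'z::euclidean_space) \<Rightarrow> nat \<Rightarrow> 'w measure" where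
  "past M Q \<xi> w k = sigma (space M)
     ((\<Union>i\<in>{1..<k}. {\<xi> i -` A \<inter> space M | A. A \<in> sets Q}) \<union>
      (\<Union>i\<in>{1..k}. {w i -` A \<inter> space M | A. A \<in> sets borel}))"

text \<open>Only meaningful for \<open>k \<ge> 1\<close>, because of the index \<open>k - 1\<close>.\<close>

definition \<Phi> ::
  "('z::euclidean_space \<Rightarrow> 'z) \<Rightarrow> real \<Rightarrow> real \<Rightarrow> real \<Rightarrow> (nat \<Rightarrow> 'w \<Rightarrow> 'z) \<Rightarrow> (nat \<Rightarrow> 'w \<Rightarrow> 'z) \<Rightarrow>
   nat \<Rightarrow> 'z \<Rightarrow> 'w \<Rightarrow> real" where
  "\<Phi> F \<alpha> p \<tau> z w k x \<omega> =
     \<alpha> * (norm (z k \<omega> - x))\<^sup>2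
     + (1 - \<alpha>) / p * (norm (w k \<omega> - x))\<^sup>2
     + 2 * \<tau> * ((F (z k \<omega>) - F (w (k - 1) \<omega>)) \<bullet> (x - z k \<omega>))
     + (1 - \<alpha>) * (norm (z k \<omega> - w (k - 1) \<omega>))\<^sup>2"

end

theory Submission
  imports Defs
begin

text \<open>
  Write \<open>\<Delta>\<^sub>k = F\<^sub>\<xi>(z\<^sub>k) - F\<^sub>\<xi>(w\<^sub>k\<^sub>-\<^sub>1)\<close> with \<open>\<xi> = \<xi>\<^sub>k\<close> for the stochastic increment, and let \<open>z*\<close> be a solution.

  The Lyapunov inequality. Monotonicity of \<open>G\<close> at \<open>z\<^sub>k\<^sub>+\<^sub>1\<close> and \<open>z*\<close> and monotonicity of \<open>F\<close>, with the
  inner products turned into squared distances, bound \<open>\<parallel>z\<^sub>k\<^sub>+\<^sub>1 - z*\<parallel>\<^sup>2\<close> plus the last two summands of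
  \<open>\<Phi>\<^sub>k\<^sub>+\<^sub>1\<close> by terms at time \<open>k\<close>, a term \<open>2 \<tau> \<langle>\<Delta>\<^sub>k, z* - z\<^sub>k\<rangle>\<close>, and the error
  \<open>2 \<tau> \<langle>\<Delta>\<^sub>k, z\<^sub>k - z\<^sub>k\<^sub>+\<^sub>1\<rangle>\<close>, which Young's inequality splits into \<open>\<parallel>\<Delta>\<^sub>k\<parallel>\<^sup>2\<close> and a fraction of
  \<open>\<parallel>z\<^sub>k\<^sub>+\<^sub>1 - z\<^sub>k\<parallel>\<^sup>2\<close> (\<open>forb_step_estimate\<close>). This holds for every outcome. Three facts about the
  conditional expectation given the past turn it into a statement about \<open>\<Phi>\<close>: the coin gives
  \<open>E\<parallel>w\<^sub>k\<^sub>+\<^sub>1 - z*\<parallel>\<^sup>2 = p E\<parallel>z\<^sub>k\<^sub>+\<^sub>1 - z*\<parallel>\<^sup>2 + (1 - p) \<parallel>w\<^sub>k - z*\<parallel>\<^sup>2\<close> (\<open>coin_average\<close>), which is why the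
  weight of \<open>w\<close> in \<open>\<Phi>\<close> is \<open>(1 - \<alpha>) / p\<close>; unbiasedness replaces \<open>\<Delta>\<^sub>k\<close> by \<open>F(z\<^sub>k) - F(w\<^sub>k\<^sub>-\<^sub>1)\<close>
  (\<open>noise_average\<close>); and the Lipschitz bound gives \<open>E\<parallel>\<Delta>\<^sub>k\<parallel>\<^sup>2 \<le> L\<^sup>2 \<parallel>z\<^sub>k - w\<^sub>k\<^sub>-\<^sub>1\<parallel>\<^sup>2\<close>
  (\<open>noise_integrable\<close>). With the chosen step size what remains is not only \<open>\<Phi>\<^sub>k\<close>: a positive
  multiple of \<open>\<parallel>z\<^sub>k - w\<^sub>k\<^sub>-\<^sub>1\<parallel>\<^sup>2 + \<parallel>z\<^sub>k\<^sub>+\<^sub>1 - z\<^sub>k\<parallel>\<^sup>2\<close> is lost in every step (\<open>\<Phi>_drift\<close>). The same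
  step size makes the cross term of \<open>\<Phi>\<^sub>k\<close> absorbable by its squares, so \<open>\<Phi>\<^sub>k\<close> is nonnegative
  (\<open>\<Phi>_lower_bound\<close>).

  Conditional expectations enter only through their defining property: all inequalities are
  proved for integrals over events of the past. The past is contained in the sigma-algebra of the
  earlier draws, which is independent of the current draw, so in such integrals the current draw
  can be integrated out while everything else is held fixed (\<open>joint_distr_history\<close> and the
  freezing lemmas).

  Convergence. The process \<open>\<Phi>\<^sub>k(z*)\<close> is a nonnegative supermartingale, hence converges almost
  surely (\<open>nonneg_supermartingale_convergent\<close>, through Doob's upcrossing bound). The losses are
  summable in expectation, so \<open>z\<^sub>k - w\<^sub>k\<^sub>-\<^sub>1\<close>, \<open>z\<^sub>k\<^sub>+\<^sub>1 - z\<^sub>k\<close> and, by the bound on its second moment,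
  also \<open>\<Delta>\<^sub>k\<close> tend to zero almost surely (\<open>residuals_vanish\<close>). From here on one argues path by
  path: \<open>\<parallel>z\<^sub>k - z*\<parallel>\<close> converges (\<open>distance_convergent\<close>) for all \<open>z*\<close> in a countable dense set of
  solutions at once, every cluster point of \<open>z\<^sub>k\<close> is a solution because the graph of \<open>G\<close> is
  closed (\<open>cluster_point_Sol\<close>), and Opial's lemma gives convergence to a solution.
\<close>

section \<open>Monotone operators and resolvents\<close>

lemma resolvent_op_scale_iff:
  "x \<in> resolvent (op_scale t A) u \<longleftrightarrow> (\<exists>g\<in>A x. u = x + t *\<^sub>R g)"
  by (auto simp: resolvent_def op_scale_def)

lemma resolvent_nonexpansive:
  fixes A :: "'z::real_inner \<Rightarrow> 'z set"
  assumes "monotone_op A" "0 \<le> t"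
    and x: "x \<in> resolvent (op_scale t A) u" and y: "y \<in> resolvent (op_scale t A) v"
  shows "norm (x - y) \<le> norm (u - v)"
proof -
  obtain g h where g: "g \<in> A x" "u = x + t *\<^sub>R g" and h: "h \<in> A y" "v = y + t *\<^sub>R h"
    using x y by (auto simp: resolvent_op_scale_iff)
  have "0 \<le> t * ((g - h) \<bullet> (x - y))"
    using assms(1,2) g(1) h(1) by (simp add: monotone_op_def)
  also have "\<dots> = (u - v) \<bullet> (x - y) - (x - y) \<bullet> (x - y)"
    by (simp add: g(2) h(2) inner_simps algebra_simps)
  finally have "norm (x - y) * norm (x - y) \<le> (u - v) \<bullet> (x - y)"
    by (simp add: power2_norm_eq_inner[symmetric] power2_eq_square)
  also have "\<dots> \<le> norm (u - v) * norm (x - y)"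
    by (rule norm_cauchy_schwarz)
  finally show ?thesis
    by (metis mult_right_le_imp_le norm_ge_zero order_le_less)
qed

lemma resolvent_unique:
  fixes A :: "'z::real_inner \<Rightarrow> 'z set"
  assumes "monotone_op A" "0 \<le> t"
    and "x \<in> resolvent (op_scale t A) u" "y \<in> resolvent (op_scale t A) u"
  shows "x = y"
  using resolvent_nonexpansive[OF assms] by simp

text \<open>If \<open>(x, u)\<close> were not in the graph, adding it would give a strictly larger monotone operator.\<close>

lemma maximally_monotone_mem:
  fixes A :: "'z::real_inner \<Rightarrow> 'z set"
  assumes "maximally_monotone A"
    and rel: "\<And>y v. v \<in> A y \<Longrightarrow> 0 \<le> (u - v) \<bullet> (x - y)"
  shows "u \<in> A x"
proof -
  define B where "B = A(x := insert u (A x))"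
  have mono: "monotone_op A"
    using assms(1) by (simp add: maximally_monotone_def)
  have rel': "0 \<le> (v - u) \<bullet> (y - x)" if "v \<in> A y" for y v
    using rel[OF that] by (simp add: inner_simps algebra_simps)
  have "monotone_op B"
    using mono rel rel' by (auto simp: monotone_op_def B_def)
  moreover have "\<forall>y. A y \<subseteq> B y"
    by (auto simp: B_def)
  ultimately have "B = A"
    using assms(1) by (auto simp: maximally_monotone_def)
  then show ?thesis
    by (metis B_def fun_upd_same insertI1)
qed

lemma maximally_monotone_closed_graph:
  fixes A :: "'z::real_inner \<Rightarrow> 'z set"
  assumes A: "maximally_monotone A"
    and mem: "\<And>n. u n \<in> A (x n)" and u: "u \<longlonglongrightarrow> u'" and x: "x \<longlonglongrightarrow> x'"
  shows "u' \<in> A x'"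
proof (rule maximally_monotone_mem[OF A])
  fix y v assume v: "v \<in> A y"
  have "(\<lambda>n. (u n - v) \<bullet> (x n - y)) \<longlonglongrightarrow> (u' - v) \<bullet> (x' - y)"
    by (intro tendsto_intros u x)
  moreover have "0 \<le> (u n - v) \<bullet> (x n - y)" for n
    using A mem[of n] v by (auto simp: maximally_monotone_def monotone_op_def)
  ultimately show "0 \<le> (u' - v) \<bullet> (x' - y)"
    by (intro LIMSEQ_le_const) auto
qed

text \<open>Totalised with the value \<open>0\<close> outside the domain of the resolvent, so that it can be
  measurable as a function on the whole space.\<close>

definition resolvent_map :: "real \<Rightarrow> ('z::euclidean_space \<Rightarrow> 'z set) \<Rightarrow> 'z \<Rightarrow> 'z" where
  "resolvent_map t A u =
     (if resolvent (op_scale t A) u \<noteq> {} then THE x. x \<in> resolvent (op_scale t A) u else 0)"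

lemma resolvent_map_eq:
  assumes "monotone_op A" "0 \<le> t" "x \<in> resolvent (op_scale t A) u"
  shows "resolvent_map t A u = x"
  unfolding resolvent_map_def
  using assms(3) resolvent_unique[OF assms(1,2)] by (auto intro: the_equality)

text \<open>On its domain the resolvent is nonexpansive, hence continuous. The domain is closed: if \<open>u\<^sub>n\<close>
  converges, nonexpansiveness makes the resolvents of \<open>u\<^sub>n\<close> a Cauchy sequence, and the closed
  graph of \<open>A\<close> identifies the limit as a resolvent of the limit.\<close>

lemma borel_measurable_resolvent_map:
  fixes A :: "'z::euclidean_space \<Rightarrow> 'z set"
  assumes A: "maximally_monotone A" and t: "0 < t"
  shows "resolvent_map t A \<in> borel_measurable borel"
proof -
  define S where "S = {u. resolvent (op_scale t A) u \<noteq> {}}"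
  define J where "J = resolvent_map t A"
  have mono: "monotone_op A"
    using A by (simp add: maximally_monotone_def)
  have J: "J u \<in> resolvent (op_scale t A) u" if "u \<in> S" for u
    using that resolvent_map_eq[OF mono less_imp_le[OF t]] by (auto simp: S_def J_def)
  have lip: "norm (J u - J v) \<le> norm (u - v)" if "u \<in> S" "v \<in> S" for u v
    using resolvent_nonexpansive[OF mono less_imp_le[OF t] J J] that by blast
  have cont: "continuous_on S J"
    unfolding continuous_on_iff dist_norm using lip by (meson le_less_trans)
  have "closed S"
    unfolding closed_sequential_limits
  proof safe
    fix u l assume u: "\<forall>n. u n \<in> S" "u \<longlonglongrightarrow> l"
    have "Cauchy (\<lambda>n. J (u n))"
      using LIMSEQ_imp_Cauchy[OF u(2)] lip u(1) unfolding Cauchy_iff by (meson le_less_trans)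
    then obtain x where x: "(\<lambda>n. J (u n)) \<longlonglongrightarrow> x"
      using Cauchy_convergent convergent_def by blast
    have "(1 / t) *\<^sub>R (u n - J (u n)) \<in> A (J (u n))" for n
    proof -
      obtain g where g: "g \<in> A (J (u n))" "u n = J (u n) + t *\<^sub>R g"
        using J[of "u n"] u(1) by (auto simp: resolvent_op_scale_iff)
      have "(1 / t) *\<^sub>R (u n - J (u n)) = g"
        using t by (subst g(2)) simp
      with g(1) show ?thesis
        by simp
    qed
    moreover have "(\<lambda>n. (1 / t) *\<^sub>R (u n - J (u n))) \<longlonglongrightarrow> (1 / t) *\<^sub>R (l - x)"
      by (intro tendsto_intros u x)
    ultimately have "(1 / t) *\<^sub>R (l - x) \<in> A x"
      by (rule maximally_monotone_closed_graph[OF A _ _ x])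
    then have "x \<in> resolvent (op_scale t A) l"
      using t by (auto simp: resolvent_op_scale_iff intro!: bexI[of _ "(1 / t) *\<^sub>R (l - x)"])
    then show "l \<in> S"
      by (auto simp: S_def)
  qed
  then have "S \<in> sets borel"
    by (rule borel_closed)
  then have "(\<lambda>u. if u \<in> S then J u else 0) \<in> borel_measurable borel"
    using cont by (intro borel_measurable_continuous_on_if) auto
  also have "(\<lambda>u. if u \<in> S then J u else 0) = resolvent_map t A"
    by (auto simp: J_def S_def resolvent_map_def)
  finally show ?thesis .
qed

section \<open>One step of the iteration\<close>

lemma Sol_iff: "z \<in> Sol F G \<longleftrightarrow> - F z \<in> G z"
  by (auto simp: Sol_def add_eq_0_iff image_iff)

text \<open>Here \<open>x\<close>, \<open>w\<close> and \<open>y\<close> stand for \<open>z\<^sub>k\<close>, \<open>w\<^sub>k\<close> and \<open>z\<^sub>k\<^sub>+\<^sub>1\<close>, and \<open>d\<close> for the stochastic increment.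
  The estimate is the sum of three inequalities: monotonicity of \<open>G\<close> at \<open>y\<close> and \<open>zs\<close>,
  monotonicity of \<open>F\<close> at the same points, and Young's inequality for \<open>d \<bullet> (x - y)\<close>, with weights
  such that a fraction \<open>1 - \<gamma>\<close> of \<open>\<alpha> \<parallel>y - x\<parallel>\<^sup>2\<close> survives.\<close>

lemma forb_step_estimate:
  fixes F :: "'z::real_inner \<Rightarrow> 'z"
  assumes G: "monotone_op G" and F: "monotone_op (\<lambda>x. {F x})"
    and sol: "zs \<in> Sol F G" and pos: "0 < \<tau>" "0 < \<alpha>" "0 < \<gamma>"
    and y: "y \<in> resolvent (op_scale \<tau> G) (\<alpha> *\<^sub>R x + (1 - \<alpha>) *\<^sub>R w - \<tau> *\<^sub>R F w - \<tau> *\<^sub>R d)"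
  shows "(norm (y - zs))\<^sup>2 + 2 * \<tau> * ((F y - F w) \<bullet> (zs - y)) + (1 - \<alpha>) * (norm (y - w))\<^sup>2
      \<le> \<alpha> * (norm (x - zs))\<^sup>2 + (1 - \<alpha>) * (norm (w - zs))\<^sup>2 + 2 * \<tau> * (d \<bullet> (zs - x))
        + \<tau>\<^sup>2 / (\<alpha> * \<gamma>) * (norm d)\<^sup>2 - (1 - \<gamma>) * \<alpha> * (norm (y - x))\<^sup>2"
proof -
  obtain g where g: "g \<in> G y"
    and eq: "\<alpha> *\<^sub>R x + (1 - \<alpha>) *\<^sub>R w - \<tau> *\<^sub>R F w - \<tau> *\<^sub>R d = y + \<tau> *\<^sub>R g"
    using y by (auto simp: resolvent_op_scale_iff)
  have "0 \<le> (g - (- F zs)) \<bullet> (y - zs)"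
    using G g sol unfolding monotone_op_def Sol_iff by blast
  then have "0 \<le> \<tau> * ((g + F zs) \<bullet> (y - zs))"
    using pos(1) by simp
  also have "\<dots> = (\<tau> *\<^sub>R g + \<tau> *\<^sub>R F zs) \<bullet> (y - zs)"
    by (simp add: inner_simps algebra_simps)
  also have "\<tau> *\<^sub>R g = \<alpha> *\<^sub>R x + (1 - \<alpha>) *\<^sub>R w - \<tau> *\<^sub>R F w - \<tau> *\<^sub>R d - y"
    using eq by (simp add: algebra_simps)
  finally have 1: "0 \<le> 2 * ((\<alpha> *\<^sub>R x + (1 - \<alpha>) *\<^sub>R w - \<tau> *\<^sub>R F w - \<tau> *\<^sub>R d - y + \<tau> *\<^sub>R F zs) \<bullet> (y - zs))"
    by simp
  have 2: "0 \<le> 2 * \<tau> * ((F y - F zs) \<bullet> (y - zs))"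
    using F pos(1) by (simp add: monotone_op_def)
  \<comment> \<open>Young's inequality, in the form of a nonnegative square.\<close>
  define e where "e = x - y"
  define c where "c = \<tau> / (\<alpha> * \<gamma>)"
  have c: "\<alpha> * \<gamma> * c = \<tau>"
    using pos by (simp add: c_def)
  have "0 \<le> \<alpha> * \<gamma> * (norm (c *\<^sub>R d - e))\<^sup>2"
    using pos by simp
  also have "\<dots> = (\<alpha> * \<gamma> * c) * c * (d \<bullet> d) - 2 * (\<alpha> * \<gamma> * c) * (d \<bullet> e) + \<alpha> * \<gamma> * (e \<bullet> e)"
    unfolding power2_norm_eq_inner
    by (simp add: inner_diff_left inner_diff_right inner_commute algebra_simps)
  also have "\<dots> = \<tau>\<^sup>2 / (\<alpha> * \<gamma>) * (d \<bullet> d) - 2 * \<tau> * (d \<bullet> (x - y)) + \<alpha> * \<gamma> * ((x - y) \<bullet> (x - y))"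
    unfolding c by (simp add: c_def e_def power2_eq_square)
  finally have 3: "2 * \<tau> * (d \<bullet> (x - y)) \<le> \<tau>\<^sup>2 / (\<alpha> * \<gamma>) * (d \<bullet> d) + \<alpha> * \<gamma> * ((x - y) \<bullet> (x - y))"
    by simp
  show ?thesis
    using 1 2 3 unfolding power2_norm_eq_inner
    by (simp add: inner_diff_left inner_diff_right inner_add_left inner_add_right inner_commute algebra_simps)
qed

section \<open>Opial's lemma\<close>

text \<open>The sequence is bounded, so it has a cluster point \<open>l\<close> in \<open>S\<close>. A point \<open>d\<close> of the dense set near
  \<open>l\<close> has a distance to the sequence which converges, and along the subsequence the limit is the
  small number \<open>\<parallel>l - d\<parallel>\<close>; so the whole sequence stays near \<open>l\<close> eventually. Convergence of the
  distances on a dense subset suffices, which permits an uncountable \<open>S\<close> when the distances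
  converge only almost surely for each point.\<close>

lemma opial_convergence:
  fixes x :: "nat \<Rightarrow> 'z::euclidean_space"
  assumes D: "D \<subseteq> S" "S \<subseteq> closure D" "S \<noteq> {}"
    and conv: "\<And>d. d \<in> D \<Longrightarrow> convergent (\<lambda>n. norm (x n - d))"
    and cluster: "\<And>l r. strict_mono r \<Longrightarrow> (x \<circ> r) \<longlonglongrightarrow> l \<Longrightarrow> l \<in> S"
  shows "\<exists>l\<in>S. x \<longlonglongrightarrow> l"
proof -
  obtain d where d: "d \<in> D"
    using D by fastforce
  obtain B where B: "\<And>n. norm (x n - d) \<le> B"
    using convergent_imp_Bseq[OF conv[OF d]] by (auto simp: Bseq_def)
  have "norm (x n) \<le> B + norm d" for n
    using B[of n] norm_triangle_sub[of "x n" d] by linarith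
  then have "bounded (range x)"
    by (auto simp: bounded_iff)
  then obtain l r where r: "strict_mono r" and lim: "(x \<circ> r) \<longlonglongrightarrow> l"
    using bounded_imp_convergent_subsequence by blast
  have l: "l \<in> S"
    using cluster[OF r lim] .
  have "x \<longlonglongrightarrow> l"
  proof (rule LIMSEQ_I)
    fix e :: real assume e: "0 < e"
    obtain d where d: "d \<in> D" "dist d l < e / 4"
      using l D(2) e closure_approachable[of l D] by (metis in_mono zero_less_divide_iff zero_less_numeral)
    obtain c where c: "(\<lambda>n. norm (x n - d)) \<longlonglongrightarrow> c"
      using conv[OF d(1)] by (auto simp: convergent_def)
    have "(\<lambda>n. norm ((x \<circ> r) n - d)) \<longlonglongrightarrow> norm (l - d)"
      by (intro tendsto_intros lim)
    moreover have "(\<lambda>n. norm ((x \<circ> r) n - d)) \<longlonglongrightarrow> c"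
      using LIMSEQ_subseq_LIMSEQ[OF c r] by (simp add: o_def)
    ultimately have "c = norm (l - d)"
      using LIMSEQ_unique by blast
    then have "c < e / 4"
      using d(2) by (simp add: dist_norm norm_minus_commute)
    then obtain N where N: "\<And>n. n \<ge> N \<Longrightarrow> norm (x n - d) < e / 4"
      using order_tendstoD(2)[OF c] unfolding eventually_sequentially by blast
    have "norm (x n - l) < e" if "n \<ge> N" for n
      using N[OF that] d(2) norm_triangle_ineq[of "x n - d" "d - l"] e by (simp add: dist_norm)
    then show "\<exists>N. \<forall>n\<ge>N. norm (x n - l) < e"
      by blast
  qed
  with l show ?thesis
    by blast
qed

section \<open>Convergence of nonnegative supermartingales\<close>

text \<open>The state is a pair: whether the sequence has been at or below \<open>a\<close> since the last completed
  upcrossing and so is waiting to reach \<open>b\<close>, and the number of completed upcrossings.\<close>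

definition upcross_step :: "real \<Rightarrow> real \<Rightarrow> bool \<times> nat \<Rightarrow> real \<Rightarrow> bool \<times> nat" where
  "upcross_step a b s y =
     (if fst s then if b \<le> y then (False, Suc (snd s)) else s else (y \<le> a, snd s))"

primrec upcross :: "real \<Rightarrow> real \<Rightarrow> (nat \<Rightarrow> real) \<Rightarrow> nat \<Rightarrow> bool \<times> nat" where
  "upcross a b x 0 = (x 0 \<le> a, 0)"
| "upcross a b x (Suc n) = upcross_step a b (upcross a b x n) (x (Suc n))"

lemma upcross_count_Suc: "snd (upcross a b x n) \<le> snd (upcross a b x (Suc n))"
  by (simp add: upcross_step_def)

lemma upcross_count_mono: "m \<le> n \<Longrightarrow> snd (upcross a b x m) \<le> snd (upcross a b x n)"
  using upcross_count_Suc by (rule lift_Suc_mono_le)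

lemma upcross_count_le: "snd (upcross a b x n) \<le> n"
  by (induction n) (auto simp: upcross_step_def)

lemma upcross_count_unbounded:
  assumes low: "\<And>N. \<exists>n\<ge>N. x n \<le> a" and high: "\<And>N. \<exists>n\<ge>N. b \<le> x n"
  shows "\<exists>n. K \<le> snd (upcross a b x n)"
proof (induction K)
  case (Suc K)
  then obtain n where n: "K \<le> snd (upcross a b x n)" by blast
  have "\<exists>m\<ge>n. fst (upcross a b x m)"
  proof (rule ccontr)
    assume *: "\<not> (\<exists>m\<ge>n. fst (upcross a b x m))"
    obtain m where m: "m \<ge> Suc n" "x m \<le> a" using low by blast
    then obtain j where j: "m = Suc j" by (cases m) auto
    have "\<not> fst (upcross a b x j)" using * m j by auto
    then have "fst (upcross a b x m)" using m j by (simp add: upcross_step_def)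
    with * m show False by auto
  qed
  then obtain m where m: "m \<ge> n" "fst (upcross a b x m)" by blast
  have "\<exists>j>m. \<not> fst (upcross a b x j)"
  proof (rule ccontr)
    assume *: "\<not> (\<exists>j>m. \<not> fst (upcross a b x j))"
    obtain j where j: "j \<ge> Suc m" "b \<le> x j" using high by blast
    then obtain i where i: "j = Suc i" by (cases j) auto
    have "fst (upcross a b x i)" using * m(2) j i by (cases "i = m") auto
    then have "\<not> fst (upcross a b x j)" using j i by (simp add: upcross_step_def)
    with * j show False by auto
  qed
  then obtain j where j: "j > m" "\<not> fst (upcross a b x j)"
    and least: "\<And>i. m < i \<Longrightarrow> i < j \<Longrightarrow> fst (upcross a b x i)"
    using exists_least_iff[of "\<lambda>j. m < j \<and> \<not> fst (upcross a b x j)"] by blast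
  then obtain i where i: "j = Suc i" by (cases j) auto
  have "fst (upcross a b x i)" using least[of i] m(2) j i by (cases "i = m") auto
  then have "snd (upcross a b x j) = Suc (snd (upcross a b x i))"
    using j(2) i by (auto simp: upcross_step_def split: if_splits)
  moreover have "snd (upcross a b x n) \<le> snd (upcross a b x i)"
    using j(1) i m(1) by (intro upcross_count_mono) simp
  ultimately show ?case using n by (metis Suc_le_mono le_trans)
qed auto

text \<open>If the lower limit were smaller than the upper limit, there would be rationals \<open>a < b\<close> strictly
  between them, and the sequence would cross from \<open>a\<close> to \<open>b\<close> infinitely often. The bound \<open>C\<close> along a
  subsequence excludes divergence to infinity.\<close>

lemma convergent_if_upcrossings_bounded:
  fixes x :: "nat \<Rightarrow> real"
  assumes nonneg: "\<And>n. 0 \<le> x n" and C: "\<And>N. \<exists>n\<ge>N. x n \<le> C"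
    and bdd: "\<And>a b. a \<in> \<rat> \<Longrightarrow> b \<in> \<rat> \<Longrightarrow> 0 < a \<Longrightarrow> a < b \<Longrightarrow> \<exists>K. \<forall>n. snd (upcross a b x n) \<le> K"
  shows "convergent x"
proof -
  define l where "l = liminf (\<lambda>n. ereal (x n))"
  define u where "u = limsup (\<lambda>n. ereal (x n))"
  have "l \<le> ereal C"
  proof (rule ccontr)
    assume "\<not> l \<le> ereal C"
    then have "\<forall>\<^sub>F n in sequentially. ereal C < ereal (x n)"
      unfolding l_def by (intro less_LiminfD) auto
    with C show False
      unfolding eventually_sequentially by (metis less_ereal.simps(1) not_less)
  qed
  moreover have "0 \<le> l"
    unfolding l_def by (intro Liminf_bounded) (auto simp: nonneg)
  moreover have "u \<le> l"
  proof (rule ccontr)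
    assume "\<not> u \<le> l"
    then obtain a where a: "l < ereal (real_of_rat a)" "ereal (real_of_rat a) < u"
      using ereal_dense3[of l u] by (auto simp: not_le)
    then obtain b where b: "ereal (real_of_rat a) < ereal (real_of_rat b)" "ereal (real_of_rat b) < u"
      using ereal_dense3[of "ereal (real_of_rat a)" u] by auto
    have "0 < real_of_rat a"
      using \<open>0 \<le> l\<close> a(1) by (metis ereal_less(2) le_less_trans)
    then obtain K where K: "\<And>n. snd (upcross (real_of_rat a) (real_of_rat b) x n) \<le> K"
      using bdd[of "real_of_rat a" "real_of_rat b"] b(1) by auto
    have "\<exists>n\<ge>N. x n \<le> real_of_rat a" for N
    proof (rule ccontr)
      assume "\<not> ?thesis"
      then have "\<forall>\<^sub>F n in sequentially. ereal (real_of_rat a) \<le> ereal (x n)"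
        unfolding eventually_sequentially by (metis ereal_less_eq(3) linear)
      then have "ereal (real_of_rat a) \<le> l"
        unfolding l_def by (rule Liminf_bounded)
      with a(1) show False by simp
    qed
    moreover have "\<exists>n\<ge>N. real_of_rat b \<le> x n" for N
    proof (rule ccontr)
      assume "\<not> ?thesis"
      then have "\<forall>\<^sub>F n in sequentially. ereal (x n) \<le> ereal (real_of_rat b)"
        unfolding eventually_sequentially by (metis ereal_less_eq(3) linear)
      then have "u \<le> ereal (real_of_rat b)"
        unfolding u_def by (rule Limsup_bounded)
      with b(2) show False by simp
    qed
    ultimately obtain n where "Suc K \<le> snd (upcross (real_of_rat a) (real_of_rat b) x n)"
      using upcross_count_unbounded by meson
    with K[of n] show False by simp
  qed
  moreover have "l \<le> u"
    unfolding l_def u_def by (intro Liminf_le_Limsup) simp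
  ultimately obtain r where r: "l = ereal r" "u = ereal r"
    by (cases l) auto
  have "(\<lambda>n. ereal (x n)) \<longlonglongrightarrow> ereal r"
    using r unfolding l_def u_def by (intro Liminf_eq_Limsup) auto
  then show ?thesis
    by (auto simp: convergent_def)
qed

lemma measurable_upcross:
  assumes X: "\<And>n. X n \<in> borel_measurable (\<F> n)"
    and mono: "\<And>n. sets (\<F> n) \<subseteq> sets (\<F> (Suc n))" and space: "\<And>n. space (\<F> n) = S"
  shows "(\<lambda>\<omega>. upcross a b (\<lambda>i. X i \<omega>) n) \<in> measurable (\<F> n) (count_space UNIV)"
proof (induction n)
  case 0
  note X[of 0, measurable]
  have [simp]: "(\<lambda>\<omega>. (X 0 \<omega> \<le> a, 0::nat)) = (\<lambda>\<omega>. if X 0 \<omega> \<le> a then (True, 0) else (False, 0))"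
    by auto
  show ?case by simp
next
  case (Suc n)
  note X[of "Suc n", measurable]
  have "measurable (\<F> n) (count_space UNIV) \<subseteq> measurable (\<F> (Suc n)) (count_space UNIV :: (bool \<times> nat) measure)"
    using mono space by (intro measurable_mono) auto
  with Suc have [measurable]: "(\<lambda>\<omega>. upcross a b (\<lambda>i. X i \<omega>) n) \<in> measurable (\<F> (Suc n)) (count_space UNIV)"
    by blast
  have "(\<lambda>\<omega>. upcross_step a b s (X (Suc n) \<omega>)) \<in> measurable (\<F> (Suc n)) (count_space UNIV)" for s
  proof (cases "fst s")
    case False
    then have "(\<lambda>\<omega>. upcross_step a b s (X (Suc n) \<omega>)) =
        (\<lambda>\<omega>. if X (Suc n) \<omega> \<le> a then (True, snd s) else (False, snd s))"
      by (auto simp: upcross_step_def)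
    then show ?thesis by simp
  qed (simp add: upcross_step_def)
  then show ?case
    unfolding upcross.simps
    by (rule measurable_compose_countable) measurable
qed

text \<open>Doob's upcrossing inequality, through a potential: \<open>b - a\<close> for every completed upcrossing plus,
  while an upcrossing is under way, the current value minus \<open>a\<close>. Starting an upcrossing (at a
  value at most \<open>a\<close>) and completing one (at a value at least \<open>b\<close>) can only lower the potential, and
  otherwise it moves with \<open>X\<close>, so it is a supermartingale that starts at or below \<open>0\<close>. As \<open>X\<close> is
  nonnegative, the potential is at least \<open>b - a\<close> times the count minus \<open>a\<close>.\<close>

lemma (in prob_space) upcross_expectation:
  fixes X :: "nat \<Rightarrow> 'a \<Rightarrow> real"
  assumes subalg: "\<And>n. subalgebra M (\<F> n)" and mono: "\<And>n. sets (\<F> n) \<subseteq> sets (\<F> (Suc n))"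
    and X: "\<And>n. X n \<in> borel_measurable (\<F> n)" and int: "\<And>n. integrable M (X n)"
    and nonneg: "\<And>n \<omega>. \<omega> \<in> space M \<Longrightarrow> 0 \<le> X n \<omega>"
    and super: "\<And>n A. A \<in> sets (\<F> n) \<Longrightarrow> (\<integral>\<omega>\<in>A. X (Suc n) \<omega> \<partial>M) \<le> (\<integral>\<omega>\<in>A. X n \<omega> \<partial>M)"
    and ab: "0 < a" "a < b"
  shows "integrable M (\<lambda>\<omega>. real (snd (upcross a b (\<lambda>i. X i \<omega>) n)))"
    and "(b - a) * expectation (\<lambda>\<omega>. real (snd (upcross a b (\<lambda>i. X i \<omega>) n))) \<le> a"
proof -
  have space: "space (\<F> n) = space M" for n
    using subalg by (simp add: subalgebra_def)
  define U where "U n \<omega> = upcross a b (\<lambda>i. X i \<omega>) n" for n \<omega>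
  define A where "A n = {\<omega> \<in> space M. fst (U n \<omega>)}" for n
  define c where "c n \<omega> = real (snd (U n \<omega>))" for n \<omega>
  define V where "V n \<omega> = c n \<omega> * (b - a) + indicator (A n) \<omega> * (X n \<omega> - a)" for n \<omega>
  have U[measurable]: "U n \<in> measurable (\<F> n) (count_space UNIV)" for n
    unfolding U_def by (rule measurable_upcross[where \<F> = \<F>, OF X mono space])
  have [measurable]: "(\<lambda>\<omega>. fst (U n \<omega>)) \<in> measurable (\<F> n) (count_space UNIV)"
    "(\<lambda>\<omega>. snd (U n \<omega>)) \<in> measurable (\<F> n) (count_space UNIV)" for n
    by (rule measurable_compose[OF U], simp)+
  have A_F: "A n \<in> sets (\<F> n)" for n
    unfolding A_def space[of n, symmetric] by measurable
  then have A[measurable]: "A n \<in> events" for n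
    using subalg by (auto simp: subalgebra_def)
  have "c n \<in> borel_measurable (\<F> n)" for n
    unfolding c_def by measurable
  then have [measurable]: "c n \<in> borel_measurable M" for n
    using measurable_from_subalg[OF subalg] by blast
  have int_c: "integrable M (c n)" for n
    by (rule integrable_const_bound[of _ "real n"]) (auto simp: c_def U_def upcross_count_le)
  have int_ind: "integrable M (\<lambda>\<omega>. indicator (A n) \<omega> * (X m \<omega> - a))" for n m
    using integrable_mult_indicator[OF A, of "\<lambda>\<omega>. X m \<omega> - a"] int by simp
  have int_V: "integrable M (V n)" for n
    unfolding V_def using int_c int_ind by simp
  have expand: "expectation (\<lambda>\<omega>. c n \<omega> * (b - a) + indicator (A n) \<omega> * (X m \<omega> - a)) =
      expectation (c n) * (b - a) + (\<integral>\<omega>\<in>A n. X m \<omega> \<partial>M) - a * prob (A n)" for n m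
  proof -
    have "(\<lambda>\<omega>. c n \<omega> * (b - a) + indicator (A n) \<omega> * (X m \<omega> - a)) =
        (\<lambda>\<omega>. c n \<omega> * (b - a) + indicator (A n) \<omega> * X m \<omega> - a * indicator (A n) \<omega>)"
      by (simp add: fun_eq_iff algebra_simps)
    moreover have "integrable M (\<lambda>\<omega>. indicator (A n) \<omega> * X m \<omega>)"
      using integrable_mult_indicator[OF A int] by simp
    moreover have "integrable M (indicator (A n) :: _ \<Rightarrow> real)"
      by (simp add: less_top[symmetric])
    ultimately show ?thesis
      using int_c by (simp add: set_lebesgue_integral_def)
  qed
  have step: "expectation (V (Suc n)) \<le> expectation (V n)" for n
  proof -
    have "expectation (V (Suc n)) \<le> expectation (\<lambda>\<omega>. c n \<omega> * (b - a) + indicator (A n) \<omega> * (X (Suc n) \<omega> - a))"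
    proof (rule integral_mono[OF int_V])
      show "integrable M (\<lambda>\<omega>. c n \<omega> * (b - a) + indicator (A n) \<omega> * (X (Suc n) \<omega> - a))"
        using int_c int_ind by simp
      fix \<omega> assume "\<omega> \<in> space M"
      then show "V (Suc n) \<omega> \<le> c n \<omega> * (b - a) + indicator (A n) \<omega> * (X (Suc n) \<omega> - a)"
        using ab by (auto simp: V_def A_def c_def U_def upcross_step_def algebra_simps split: split_indicator)
    qed
    also have "\<dots> = expectation (c n) * (b - a) + (\<integral>\<omega>\<in>A n. X (Suc n) \<omega> \<partial>M) - a * prob (A n)"
      by (rule expand)
    also have "\<dots> \<le> expectation (c n) * (b - a) + (\<integral>\<omega>\<in>A n. X n \<omega> \<partial>M) - a * prob (A n)"
      using super[OF A_F] by simp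
    also have "\<dots> = expectation (V n)"
      unfolding V_def by (rule expand[symmetric])
    finally show ?thesis .
  qed
  have "expectation (V n) \<le> 0" for n
  proof (induction n)
    case 0
    have "V 0 \<omega> \<le> 0" for \<omega>
      by (auto simp: V_def A_def c_def U_def split: split_indicator)
    then show ?case using integral_mono[OF int_V[of 0], of "\<lambda>_. 0"] by simp
  qed (use step order_trans in blast)
  moreover have "expectation (\<lambda>\<omega>. (b - a) * c n \<omega> - a) \<le> expectation (V n)"
  proof (rule integral_mono)
    fix \<omega> assume "\<omega> \<in> space M"
    then show "(b - a) * c n \<omega> - a \<le> V n \<omega>"
      using nonneg[of \<omega> n] ab by (auto simp: V_def split: split_indicator)
  qed (use int_c int_V in auto)
  moreover have "expectation (\<lambda>\<omega>. (b - a) * c n \<omega> - a) = (b - a) * expectation (c n) - a"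
    using int_c by (simp add: prob_space)
  ultimately have "(b - a) * expectation (c n) \<le> a"
    by (smt (verit))
  then show "(b - a) * expectation (\<lambda>\<omega>. real (snd (upcross a b (\<lambda>i. X i \<omega>) n))) \<le> a"
    unfolding c_def U_def .
  show "integrable M (\<lambda>\<omega>. real (snd (upcross a b (\<lambda>i. X i \<omega>) n)))"
    using int_c[of n] unfolding c_def U_def .
qed

text \<open>The expected number of upcrossings is bounded uniformly in time, so almost surely only finitely
  many upcrossings occur, simultaneously for all pairs of rationals.\<close>

lemma (in prob_space) nonneg_supermartingale_convergent:
  fixes X :: "nat \<Rightarrow> 'a \<Rightarrow> real"
  assumes subalg: "\<And>n. subalgebra M (\<F> n)" and mono: "\<And>n. sets (\<F> n) \<subseteq> sets (\<F> (Suc n))"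
    and X: "\<And>n. X n \<in> borel_measurable (\<F> n)" and int: "\<And>n. integrable M (X n)"
    and nonneg: "\<And>n \<omega>. \<omega> \<in> space M \<Longrightarrow> 0 \<le> X n \<omega>"
    and super: "\<And>n A. A \<in> sets (\<F> n) \<Longrightarrow> (\<integral>\<omega>\<in>A. X (Suc n) \<omega> \<partial>M) \<le> (\<integral>\<omega>\<in>A. X n \<omega> \<partial>M)"
  shows "AE \<omega> in M. convergent (\<lambda>n. X n \<omega>)"
proof -
  have X_M[measurable]: "X n \<in> borel_measurable M" for n
    using int by auto
  have bdd: "AE \<omega> in M. \<exists>K. \<forall>n. snd (upcross a b (\<lambda>i. X i \<omega>) n) \<le> K" if ab: "0 < a" "a < b" for a b
  proof -
    define c where "c n \<omega> = snd (upcross a b (\<lambda>i. X i \<omega>) n)" for n \<omega>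
    note up = upcross_expectation[where \<F> = \<F> and X = X, OF subalg mono X int nonneg super ab, folded c_def]
    note [measurable] = borel_measurable_integrable[OF up(1)]
    have "(\<integral>\<^sup>+\<omega>. (SUP n. ennreal (real (c n \<omega>))) \<partial>M) = (SUP n. \<integral>\<^sup>+\<omega>. ennreal (real (c n \<omega>)) \<partial>M)"
    proof (rule nn_integral_monotone_convergence_SUP)
      show "incseq (\<lambda>n \<omega>. ennreal (real (c n \<omega>)))"
        by (auto simp: incseq_def le_fun_def c_def upcross_count_mono intro!: ennreal_leI)
    qed measurable
    also have "\<dots> \<le> ennreal (a / (b - a))"
    proof (rule SUP_least)
      fix n
      have "(\<integral>\<^sup>+\<omega>. ennreal (real (c n \<omega>)) \<partial>M) = ennreal (expectation (\<lambda>\<omega>. real (c n \<omega>)))"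
        using up(1) by (intro nn_integral_eq_integral) auto
      also have "\<dots> \<le> ennreal (a / (b - a))"
        using up(2)[of n] ab by (intro ennreal_leI) (simp add: field_simps)
      finally show "(\<integral>\<^sup>+\<omega>. ennreal (real (c n \<omega>)) \<partial>M) \<le> ennreal (a / (b - a))" .
    qed
    finally have "(\<integral>\<^sup>+\<omega>. (SUP n. ennreal (real (c n \<omega>))) \<partial>M) \<le> ennreal (a / (b - a))" .
    moreover have "(\<lambda>\<omega>. SUP n. ennreal (real (c n \<omega>))) \<in> borel_measurable M"
      by measurable
    ultimately have "AE \<omega> in M. (SUP n. ennreal (real (c n \<omega>))) \<noteq> \<infinity>"
      by (intro nn_integral_PInf_AE) (auto simp: top_unique)
    then show ?thesis
    proof eventually_elim
      case (elim \<omega>)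
      then obtain r where r: "0 \<le> r" "(SUP n. ennreal (real (c n \<omega>))) = ennreal r"
        by (cases "SUP n. ennreal (real (c n \<omega>))") auto
      have "c n \<omega> \<le> nat \<lceil>r\<rceil>" for n
      proof -
        have "ennreal (real (c n \<omega>)) \<le> ennreal r"
          unfolding r(2)[symmetric] by (rule SUP_upper) simp
        then have "real (c n \<omega>) \<le> r"
          using r(1) by simp
        then show ?thesis by linarith
      qed
      then show ?case by (auto simp: c_def)
    qed
  qed
  define R where "R = {(a::real, b). a \<in> \<rat> \<and> b \<in> \<rat> \<and> 0 < a \<and> a < b}"
  have "countable (\<rat> \<times> \<rat> :: (real \<times> real) set)"
    by (intro countable_SIGMA countable_rat)
  then have "countable R"
    by (rule countable_subset[rotated]) (auto simp: R_def)
  then have all: "AE \<omega> in M. \<forall>(a, b)\<in>R. \<exists>K. \<forall>n. snd (upcross a b (\<lambda>i. X i \<omega>) n) \<le> K"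
    by (subst AE_ball_countable) (auto simp: R_def intro: bdd)
  have dec: "expectation (X n) \<le> expectation (X 0)" for n
  proof (induction n)
    case (Suc n)
    have "space M \<in> sets (\<F> n)"
      using subalg by (metis sets.top subalgebra_def)
    from super[OF this] have "expectation (X (Suc n)) \<le> expectation (X n)"
      using int by (simp add: set_integral_space)
    with Suc show ?case by linarith
  qed simp
  \<comment> \<open>Fatou's lemma excludes the limit \<open>\<infinity>\<close>.\<close>
  have "(\<integral>\<^sup>+\<omega>. liminf (\<lambda>n. ennreal (X n \<omega>)) \<partial>M) \<le> liminf (\<lambda>n. \<integral>\<^sup>+\<omega>. ennreal (X n \<omega>) \<partial>M)"
    by (rule nn_integral_liminf) simp
  also have "\<dots> = liminf (\<lambda>n. ennreal (expectation (X n)))"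
    using int nonneg by (subst nn_integral_eq_integral) auto
  also have "\<dots> \<le> limsup (\<lambda>n. ennreal (expectation (X n)))"
    by (intro Liminf_le_Limsup) simp
  also have "\<dots> \<le> ennreal (expectation (X 0))"
    by (intro Limsup_bounded always_eventually allI ennreal_leI dec)
  finally have "AE \<omega> in M. liminf (\<lambda>n. ennreal (X n \<omega>)) \<noteq> \<infinity>"
    by (intro nn_integral_PInf_AE) (auto simp: top_unique)
  with all AE_space show ?thesis
  proof eventually_elim
    case (elim \<omega>)
    obtain r where r: "0 \<le> r" "liminf (\<lambda>n. ennreal (X n \<omega>)) = ennreal r"
      using elim(3) by (cases "liminf (\<lambda>n. ennreal (X n \<omega>))") auto
    have "\<exists>n\<ge>N. X n \<omega> \<le> r + 1" for N
    proof (rule ccontr)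
      assume "\<not> ?thesis"
      then have "\<forall>\<^sub>F n in sequentially. ennreal (r + 1) \<le> ennreal (X n \<omega>)"
        unfolding eventually_sequentially by (metis ennreal_leI linear)
      then have "ennreal (r + 1) \<le> ennreal r"
        unfolding r(2)[symmetric] by (rule Liminf_bounded)
      with r(1) show False by simp
    qed
    then show ?case
      using elim(1) nonneg[OF elim(2)]
      by (intro convergent_if_upcrossings_bounded[where C = "r + 1"]) (auto simp: R_def)
  qed
qed

section \<open>Conditioning on a sub-sigma-algebra independent of a random variable\<close>

lemma measurable_ident_subalgebra: "subalgebra M N \<Longrightarrow> (\<lambda>x. x) \<in> measurable M N"
  by (auto simp: subalgebra_def measurable_def sets.Int_space_eq2 subset_iff)

text \<open>Integrate the difference over the event on which the conditional expectation exceeds \<open>g\<close>.\<close>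

lemma (in sigma_finite_subalgebra) real_cond_exp_le_of_set_integral_le:
  assumes f: "integrable M f" and g: "integrable M g" "g \<in> borel_measurable F"
    and le: "\<And>A. A \<in> sets F \<Longrightarrow> (\<integral>x\<in>A. f x \<partial>M) \<le> (\<integral>x\<in>A. g x \<partial>M)"
  shows "AE x in M. real_cond_exp M F f x \<le> g x"
proof -
  define h where "h = real_cond_exp M F f"
  have [measurable]: "h \<in> borel_measurable F" "g \<in> borel_measurable F"
    using g(2) by (auto simp: h_def)
  have h: "integrable M h"
    unfolding h_def using f by (rule real_cond_exp_int(1))
  define A where "A = {x \<in> space F. g x < h x}"
  have A_F: "A \<in> sets F"
    unfolding A_def by measurable
  then have A: "A \<in> sets M"
    using subalg by (auto simp: subalgebra_def)
  have int: "integrable M (\<lambda>x. indicator A x * h x)" "integrable M (\<lambda>x. indicator A x * g x)"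
    using integrable_mult_indicator[OF A h] integrable_mult_indicator[OF A g(1)] by simp_all
  have nonneg: "0 \<le> indicator A x * h x - indicator A x * g x" for x
    by (auto simp: A_def split: split_indicator)
  have "(\<integral>x. indicator A x * h x - indicator A x * g x \<partial>M) \<le> 0"
    using le[OF A_F] real_cond_exp_intA[OF f A_F] int
    by (simp add: set_lebesgue_integral_def h_def)
  then have "(\<integral>x. indicator A x * h x - indicator A x * g x \<partial>M) = 0"
    using nonneg by (intro antisym integral_nonneg) auto
  then have "AE x in M. indicator A x * h x - indicator A x * g x = 0"
    using int nonneg by (subst (asm) integral_nonneg_eq_0_iff_AE) auto
  with AE_space show ?thesis
  proof eventually_elim
    case (elim x)
    then show ?case
      using subalg by (auto simp: A_def h_def subalgebra_def not_less split: split_indicator_asm)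
  qed
qed

text \<open>A sub-sigma-algebra \<open>N\<close> of the sigma-algebra generated by the variables with index in \<open>J\<close> is
  independent of a variable with index outside \<open>J\<close>. Independence of \<open>N\<close> is expressed by
  letting the outcome \<open>\<omega>\<close>, observed through \<open>N\<close>, be one of the two components of the joint law.\<close>

lemma (in prob_space) joint_distr_history:
  assumes indep: "indep_vars T Y I" and J: "J \<subseteq> I" "k \<in> I" "k \<notin> J"
    and N: "space N = space M"
    and sub: "sets N \<subseteq> sets (vimage_algebra (space M) (\<lambda>\<omega>. restrict (\<lambda>i. Y i \<omega>) J) (PiM J T))"
  shows "subalgebra M N"
    and "distr M (N \<Otimes>\<^sub>M T k) (\<lambda>\<omega>. (\<omega>, Y k \<omega>)) = distr M N (\<lambda>\<omega>. \<omega>) \<Otimes>\<^sub>M distr M (T k) (Y k)"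
proof -
  define H where "H = (\<lambda>\<omega>. restrict (\<lambda>i. Y i \<omega>) J)"
  define K where "K = (\<lambda>\<omega>. restrict (\<lambda>i. Y i \<omega>) {k})"
  have Y[measurable]: "random_variable (T k) (Y k)"
    using indep J(2) by (auto simp: indep_vars_def)
  have HK: "indep_var (PiM J T) H (PiM {k} T) K"
    unfolding H_def K_def using J by (intro indep_var_restrict[OF indep]) auto
  have H: "H \<in> space M \<rightarrow> space (PiM J T)"
    using indep_var_rv1[OF HK] by (auto dest: measurable_space)
  have K: "K \<in> space M \<rightarrow> space (PiM {k} T)"
    using indep_var_rv2[OF HK] by (auto dest: measurable_space)
  let ?S = "sigma_sets (space M) {H -` A \<inter> space M | A. A \<in> sets (PiM J T)}"
  let ?R = "sigma_sets (space M) {K -` A \<inter> space M | A. A \<in> sets (PiM {k} T)}"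
  have sub': "sets N \<subseteq> ?S"
    using sub by (simp add: H_def[symmetric] sets_vimage_algebra)
  have set: "indep_set ?S ?R"
    using HK unfolding indep_var_eq by auto
  have "sets N \<subseteq> events"
    using sub' set by (auto simp: indep_sets2_eq)
  with N show "subalgebra M N"
    by (simp add: subalgebra_def)
  then have id[measurable]: "(\<lambda>\<omega>. \<omega>) \<in> measurable M N"
    by (rule measurable_ident_subalgebra)
  have prod: "prob (A \<inter> (Y k -` B \<inter> space M)) = prob A * prob (Y k -` B \<inter> space M)"
    if A: "A \<in> sets N" and B: "B \<in> sets (T k)" for A B
  proof -
    have "{f \<in> space (PiM {k} T). f k \<in> B} \<in> sets (PiM {k} T)"
      using B by measurable
    moreover have "Y k -` B \<inter> space M = K -` {f \<in> space (PiM {k} T). f k \<in> B} \<inter> space M"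
      using K by (auto simp: K_def)
    ultimately have "Y k -` B \<inter> space M \<in> ?R"
      by (intro sigma_sets.Basic) blast
    moreover have "A \<in> ?S"
      using sub' A by blast
    ultimately show ?thesis
      using set by (simp add: indep_sets2_eq)
  qed
  interpret N: prob_space "distr M N (\<lambda>\<omega>. \<omega>)" by (rule prob_space_distr) simp
  interpret Yk: prob_space "distr M (T k) (Y k)" by (rule prob_space_distr) simp
  show "distr M (N \<Otimes>\<^sub>M T k) (\<lambda>\<omega>. (\<omega>, Y k \<omega>)) = distr M N (\<lambda>\<omega>. \<omega>) \<Otimes>\<^sub>M distr M (T k) (Y k)"
  proof (rule pair_measure_eqI[symmetric])
    fix A B assume A: "A \<in> sets (distr M N (\<lambda>\<omega>. \<omega>))" and B: "B \<in> sets (distr M (T k) (Y k))"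
    have "(\<lambda>\<omega>. (\<omega>, Y k \<omega>)) -` (A \<times> B) \<inter> space M = A \<inter> (Y k -` B \<inter> space M)"
      by auto
    moreover have "(\<lambda>\<omega>. \<omega>) -` A \<inter> space M = A"
      using A N sets.sets_into_space[of A N] by auto
    ultimately show "emeasure (distr M N (\<lambda>\<omega>. \<omega>)) A * emeasure (distr M (T k) (Y k)) B =
        emeasure (distr M (N \<Otimes>\<^sub>M T k) (\<lambda>\<omega>. (\<omega>, Y k \<omega>))) (A \<times> B)"
      using A B prod[of A B]
      by (simp add: emeasure_distr emeasure_eq_measure ennreal_mult'')
  qed (simp_all add: N.sigma_finite_measure Yk.sigma_finite_measure cong: sets_pair_measure_cong)
qed

text \<open>The joint law is a product measure, so Fubini's theorem integrates out \<open>Y\<close> with \<open>\<omega>\<close> held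
  fixed, although the integrand depends on \<open>\<omega>\<close> also through \<open>Y\<close>.\<close>

lemma (in prob_space) nn_integral_freezing:
  assumes sub: "subalgebra M N" and Y[measurable]: "Y \<in> measurable M T"
    and joint: "distr M (N \<Otimes>\<^sub>M T) (\<lambda>\<omega>. (\<omega>, Y \<omega>)) = distr M N (\<lambda>\<omega>. \<omega>) \<Otimes>\<^sub>M distr M T Y"
    and h[measurable]: "h \<in> borel_measurable (N \<Otimes>\<^sub>M T)"
  shows "(\<integral>\<^sup>+\<omega>. h (\<omega>, Y \<omega>) \<partial>M) = (\<integral>\<^sup>+\<omega>. (\<integral>\<^sup>+y. h (\<omega>, y) \<partial>distr M T Y) \<partial>M)"
proof -
  note [measurable] = measurable_ident_subalgebra[OF sub]
  interpret Y: prob_space "distr M T Y" by (rule prob_space_distr) simp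
  have [measurable]: "(\<lambda>\<omega>. \<integral>\<^sup>+y. h (\<omega>, y) \<partial>distr M T Y) \<in> borel_measurable N"
    by measurable
  have "(\<integral>\<^sup>+\<omega>. h (\<omega>, Y \<omega>) \<partial>M) = (\<integral>\<^sup>+x. h x \<partial>distr M (N \<Otimes>\<^sub>M T) (\<lambda>\<omega>. (\<omega>, Y \<omega>)))"
    by (simp add: nn_integral_distr)
  also have "\<dots> = (\<integral>\<^sup>+\<omega>. (\<integral>\<^sup>+y. h (\<omega>, y) \<partial>distr M T Y) \<partial>distr M N (\<lambda>\<omega>. \<omega>))"
    unfolding joint by (subst Y.nn_integral_fst[symmetric]) auto
  also have "\<dots> = (\<integral>\<^sup>+\<omega>. (\<integral>\<^sup>+y. h (\<omega>, y) \<partial>distr M T Y) \<partial>M)"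
    by (simp add: nn_integral_distr)
  finally show ?thesis .
qed

lemma (in prob_space) integral_freezing:
  fixes h :: "_ \<Rightarrow> real"
  assumes sub: "subalgebra M N" and Y[measurable]: "Y \<in> measurable M T"
    and joint: "distr M (N \<Otimes>\<^sub>M T) (\<lambda>\<omega>. (\<omega>, Y \<omega>)) = distr M N (\<lambda>\<omega>. \<omega>) \<Otimes>\<^sub>M distr M T Y"
    and h[measurable]: "h \<in> borel_measurable (N \<Otimes>\<^sub>M T)"
    and int: "integrable M (\<lambda>\<omega>. h (\<omega>, Y \<omega>))"
  shows "(\<integral>\<omega>. h (\<omega>, Y \<omega>) \<partial>M) = (\<integral>\<omega>. (\<integral>y. h (\<omega>, y) \<partial>distr M T Y) \<partial>M)"
proof -
  note [measurable] = measurable_ident_subalgebra[OF sub]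
  interpret Y: prob_space "distr M T Y" by (rule prob_space_distr) simp
  interpret X: prob_space "distr M N (\<lambda>\<omega>. \<omega>)" by (rule prob_space_distr) simp
  interpret XY: pair_prob_space "distr M N (\<lambda>\<omega>. \<omega>)" "distr M T Y" ..
  have [measurable]: "(\<lambda>\<omega>. \<integral>y. h (\<omega>, y) \<partial>distr M T Y) \<in> borel_measurable N"
    by measurable
  have "(\<integral>\<omega>. h (\<omega>, Y \<omega>) \<partial>M) = (\<integral>x. h x \<partial>distr M (N \<Otimes>\<^sub>M T) (\<lambda>\<omega>. (\<omega>, Y \<omega>)))"
    by (simp add: integral_distr)
  also have "\<dots> = (\<integral>\<omega>. (\<integral>y. h (\<omega>, y) \<partial>distr M T Y) \<partial>distr M N (\<lambda>\<omega>. \<omega>))"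
    unfolding joint
    by (subst XY.integral_fst'[symmetric]) (auto simp: joint[symmetric] integrable_distr_eq int)
  also have "\<dots> = (\<integral>\<omega>. (\<integral>y. h (\<omega>, y) \<partial>distr M T Y) \<partial>M)"
    by (simp add: integral_distr)
  finally show ?thesis .
qed

lemma AE_tendsto_zero_if_integral_sum_bounded:
  fixes f :: "nat \<Rightarrow> 'a \<Rightarrow> real"
  assumes int: "\<And>n. integrable M (f n)" and nonneg: "\<And>n x. 0 \<le> f n x"
    and bdd: "\<And>n. (\<Sum>i<n. \<integral>x. f i x \<partial>M) \<le> C"
  shows "AE x in M. (\<lambda>n. f n x) \<longlonglongrightarrow> 0"
proof -
  note [measurable] = borel_measurable_integrable[OF int]
  have "(\<integral>\<^sup>+x. (\<Sum>n. ennreal (f n x)) \<partial>M) = (\<Sum>n. \<integral>\<^sup>+x. ennreal (f n x) \<partial>M)"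
    by (rule nn_integral_suminf) simp
  also have "\<dots> = (\<Sum>n. ennreal (\<integral>x. f n x \<partial>M))"
    using int nonneg by (subst nn_integral_eq_integral) auto
  also have "\<dots> \<le> ennreal C"
    by (rule suminf_le_const) (use nonneg bdd in \<open>auto intro!: ennreal_leI simp: sum_ennreal integral_nonneg\<close>)
  finally have "AE x in M. (\<Sum>n. ennreal (f n x)) \<noteq> \<infinity>"
    by (intro nn_integral_PInf_AE) (auto simp: top_unique)
  then show ?thesis
  proof eventually_elim
    case (elim x)
    then have "summable (\<lambda>n. f n x)"
      using nonneg by (intro summable_suminf_not_top) auto
    then show ?case
      by (rule summable_LIMSEQ_zero)
  qed
qed

lemma (in prob_space) power2_expectation_le:
  assumes "integrable M X" "integrable M (\<lambda>x. (X x)\<^sup>2 :: real)"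
  shows "(expectation X)\<^sup>2 \<le> expectation (\<lambda>x. (X x)\<^sup>2)"
  using variance_eq[OF assms] variance_positive[of X] by linarith
section \<open>Elementary estimates and the Lipschitz constant of the mean operator\<close>

lemma nn_integral_indicator_eq_set_integral:
  fixes f :: "'a \<Rightarrow> real"
  assumes "A \<in> sets M" "integrable M f" "\<And>x. 0 \<le> f x"
  shows "(\<integral>\<^sup>+x. indicator A x * ennreal (f x) \<partial>M) = ennreal (\<integral>x\<in>A. f x \<partial>M)"
proof -
  have "(\<integral>\<^sup>+x. indicator A x * ennreal (f x) \<partial>M) = (\<integral>\<^sup>+x. ennreal (indicator A x * f x) \<partial>M)"
    by (intro nn_integral_cong) (simp split: split_indicator)
  also have "\<dots> = ennreal (\<integral>x. indicator A x * f x \<partial>M)"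
    using integrable_mult_indicator[OF assms(1,2)] assms(3) by (intro nn_integral_eq_integral) auto
  finally show ?thesis
    by (simp add: set_lebesgue_integral_def)
qed

lemma sum4_squared_le: "(a + b + c + d)\<^sup>2 \<le> 4 * (a\<^sup>2 + b\<^sup>2 + c\<^sup>2 + d\<^sup>2)" for a b c d :: real
proof -
  have "4 * (a\<^sup>2 + b\<^sup>2 + c\<^sup>2 + d\<^sup>2) - (a + b + c + d)\<^sup>2 =
      (a - b)\<^sup>2 + (a - c)\<^sup>2 + (a - d)\<^sup>2 + (b - c)\<^sup>2 + (b - d)\<^sup>2 + (c - d)\<^sup>2"
    by (simp add: power2_eq_square algebra_simps)
  then show ?thesis
    by (smt (verit) zero_le_power2)
qed

lemma norm_diff_squared_le: "(norm (a - b))\<^sup>2 \<le> 2 * (norm (a - x))\<^sup>2 + 2 * (norm (b - x))\<^sup>2"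
  for a b x :: "'a::real_normed_vector"
proof -
  have "norm (a - b) \<le> norm (a - x) + norm (b - x)"
    using norm_triangle_ineq4[of "a - x" "b - x"] by simp
  then have "(norm (a - b))\<^sup>2 \<le> (norm (a - x) + norm (b - x))\<^sup>2"
    by (intro power_mono) auto
  also have "\<dots> \<le> 2 * (norm (a - x))\<^sup>2 + 2 * (norm (b - x))\<^sup>2"
    using sum_squares_bound[of "norm (a - x)" "norm (b - x)"] by (simp add: power2_sum)
  finally show ?thesis .
qed

text \<open>Jensen's inequality: the mean of \<open>F\<^sub>\<xi>(u) - F\<^sub>\<xi>(v)\<close> has norm at most its root mean square.\<close>

lemma (in prob_space) stochastic_oracle_lipschitz:
  assumes "stochastic_oracle M Fo F L" "0 < L"
  shows "norm (F u - F v) \<le> L * norm (u - v)"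
proof -
  note so = assms(1)[unfolded stochastic_oracle_def]
  have int: "integrable M (\<lambda>s. Fo s u - Fo s v)" and eq: "expectation (\<lambda>s. Fo s u - Fo s v) = F u - F v"
    using so[THEN conjunct2, THEN conjunct2, THEN conjunct1]
    by (simp_all add: has_bochner_integral_iff)
  note [measurable] = borel_measurable_integrable[OF int]
  have le: "(\<integral>\<^sup>+s. ennreal ((norm (Fo s u - Fo s v))\<^sup>2) \<partial>M) \<le> ennreal (L\<^sup>2 * (norm (u - v))\<^sup>2)"
    using so by blast
  have int2: "integrable M (\<lambda>s. (norm (Fo s u - Fo s v))\<^sup>2)"
  proof (rule integrableI_bounded)
    have "(\<integral>\<^sup>+s. ennreal (norm ((norm (Fo s u - Fo s v))\<^sup>2)) \<partial>M) \<le> ennreal (L\<^sup>2 * (norm (u - v))\<^sup>2)"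
      using le by simp
    then show "(\<integral>\<^sup>+s. ennreal (norm ((norm (Fo s u - Fo s v))\<^sup>2)) \<partial>M) < \<infinity>"
      by (rule le_less_trans) simp
  qed (use int in auto)
  have "(norm (F u - F v))\<^sup>2 \<le> (expectation (\<lambda>s. norm (Fo s u - Fo s v)))\<^sup>2"
    unfolding eq[symmetric] by (intro power_mono integral_norm_bound) simp
  also have "\<dots> \<le> expectation (\<lambda>s. (norm (Fo s u - Fo s v))\<^sup>2)"
    using int int2 by (intro power2_expectation_le) auto
  also have "\<dots> \<le> L\<^sup>2 * (norm (u - v))\<^sup>2"
    using le by (subst (asm) nn_integral_eq_integral[OF int2]) auto
  also have "\<dots> = (L * norm (u - v))\<^sup>2"
    by (simp add: power_mult_distrib)
  finally show ?thesis
    by (rule power2_le_imp_le) (use assms(2) in simp)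
qed

section \<open>Measurability of the iterates and independence of the draws from the past\<close>

locale forb_run = prob_space M
  for M :: "'w measure" +
  fixes F :: "'z::euclidean_space \<Rightarrow> 'z"
    and G :: "'z \<Rightarrow> 'z set"
    and Q :: "'x measure"
    and Fo :: "'x \<Rightarrow> 'z \<Rightarrow> 'z"
    and \<xi> :: "nat \<Rightarrow> 'w \<Rightarrow> 'x"
    and c :: "nat \<Rightarrow> 'w \<Rightarrow> bool"
    and z w :: "nat \<Rightarrow> 'w \<Rightarrow> 'z"
    and z\<^sub>0 :: 'z
    and L \<alpha> p \<gamma> \<tau> :: real
  assumes G: "maximally_monotone G"
    and F: "monotone_op (\<lambda>x. {F x})"
    and sol: "Sol F G \<noteq> {}"
    and L: "L > 0"
    and orc: "stochastic_oracle Q Fo F L"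
    and \<alpha>: "0 < \<alpha>" "\<alpha> < 1"
    and p: "0 < p" "p \<le> 1"
    and \<gamma>: "0 < \<gamma>" "\<gamma> < 1"
    and \<tau>_eq: "\<tau> = sqrt (\<alpha> * (1 - \<alpha>)) / L * \<gamma>"
    and draws: "independent_draws M Q p \<xi> c"
    and run: "forb_vr M F G Fo \<alpha> \<tau> z\<^sub>0 \<xi> c z w"
begin

abbreviation \<P> :: "nat \<Rightarrow> 'w measure" where
  "\<P> k \<equiv> past M Q \<xi> w k"

abbreviation \<Delta> :: "nat \<Rightarrow> 'w \<Rightarrow> 'z" where
  "\<Delta> k \<omega> \<equiv> Fo (\<xi> k \<omega>) (z k \<omega>) - Fo (\<xi> k \<omega>) (w (k - 1) \<omega>)"

sublocale Q: prob_space Q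
  using orc by (simp add: stochastic_oracle_def)

lemma G_mono: "monotone_op G"
  using G by (simp add: maximally_monotone_def)

lemma \<tau>_pos: "0 < \<tau>"
  using \<alpha> \<gamma> L by (simp add: \<tau>_eq)

lemma \<tau>_L: "\<tau> * L = \<gamma> * sqrt (\<alpha> * (1 - \<alpha>))"
  using L by (simp add: \<tau>_eq)

lemma \<tau>_L_sq: "\<tau>\<^sup>2 / (\<alpha> * \<gamma>) * L\<^sup>2 = (1 - \<alpha>) * \<gamma>"
proof -
  have "\<tau>\<^sup>2 / (\<alpha> * \<gamma>) * L\<^sup>2 = (\<tau> * L)\<^sup>2 / (\<alpha> * \<gamma>)"
    by (simp add: power_mult_distrib)
  also have "\<dots> = \<gamma>\<^sup>2 * (\<alpha> * (1 - \<alpha>)) / (\<alpha> * \<gamma>)"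
    using \<alpha> unfolding \<tau>_L power_mult_distrib by simp
  also have "\<dots> = (1 - \<alpha>) * \<gamma>"
    using \<alpha> \<gamma> by (simp add: power2_eq_square)
  finally show ?thesis .
qed

lemma lipschitz: "norm (F u - F v) \<le> L * norm (u - v)"
  by (rule Q.stochastic_oracle_lipschitz[OF orc L])

lemma F_cont: "continuous_on UNIV F"
proof -
  have "L-lipschitz_on UNIV F"
    using L lipschitz by (intro lipschitz_onI) (auto simp: dist_norm)
  then show ?thesis
    by (rule lipschitz_on_continuous_on)
qed

lemma measurable_F[measurable]: "F \<in> borel_measurable borel"
  using F_cont by (rule borel_measurable_continuous_onI)

lemma measurable_oracle[measurable (raw)]:
  assumes "f \<in> measurable N Q" "g \<in> borel_measurable N"
  shows "(\<lambda>x. Fo (f x) (g x)) \<in> borel_measurable N"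
proof -
  have "(\<lambda>(s, u). Fo s u) \<in> borel_measurable (Q \<Otimes>\<^sub>M borel)"
    using orc by (simp add: stochastic_oracle_def)
  from measurable_compose[OF measurable_Pair[OF assms] this] show ?thesis
    by simp
qed

lemma integral_oracle: "integrable Q (\<lambda>s. Fo s u)" "(\<integral>s. Fo s u \<partial>Q) = F u"
  using orc by (auto simp: stochastic_oracle_def has_bochner_integral_iff)

lemma oracle_second_moment:
  "(\<integral>\<^sup>+ s. ennreal ((norm (Fo s u - Fo s v))\<^sup>2) \<partial>Q) \<le> ennreal (L\<^sup>2 * (norm (u - v))\<^sup>2)"
  using orc by (simp add: stochastic_oracle_def)

lemma init:
  assumes "\<omega> \<in> space M"
  shows "z 0 \<omega> = z\<^sub>0" "w 0 \<omega> = z\<^sub>0" "z (Suc 0) \<omega> = z\<^sub>0" "w (Suc 0) \<omega> = z\<^sub>0"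
  using run[unfolded forb_vr_def, THEN conjunct1, rule_format, OF assms] by simp_all

lemma z_step:
  assumes "1 \<le> k" "\<omega> \<in> space M"
  shows "z (Suc k) \<omega> \<in> resolvent (op_scale \<tau> G)
    (\<alpha> *\<^sub>R z k \<omega> + (1 - \<alpha>) *\<^sub>R w k \<omega> - \<tau> *\<^sub>R F (w k \<omega>) - \<tau> *\<^sub>R \<Delta> k \<omega>)"
  using run[unfolded forb_vr_def Let_def Suc_eq_plus1[symmetric], THEN conjunct2, rule_format, OF assms] by blast

lemma w_step:
  assumes "1 \<le> k" "\<omega> \<in> space M"
  shows "w (Suc k) \<omega> = (if c k \<omega> then z (Suc k) \<omega> else w k \<omega>)"
  using run[unfolded forb_vr_def Let_def Suc_eq_plus1[symmetric], THEN conjunct2, rule_format, OF assms] by blast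

text \<open>The next iterate as a function of the outcome and of a sample that is still free, so that the
  sample can be integrated out with the outcome held fixed.\<close>

definition z_next :: "nat \<Rightarrow> 'w \<times> 'x \<Rightarrow> 'z" where
  "z_next k = (\<lambda>(\<omega>, s). resolvent_map \<tau> G
     (\<alpha> *\<^sub>R z k \<omega> + (1 - \<alpha>) *\<^sub>R w k \<omega> - \<tau> *\<^sub>R F (w k \<omega>)
        - \<tau> *\<^sub>R (Fo s (z k \<omega>) - Fo s (w (k - 1) \<omega>))))"

lemma z_step_eq:
  assumes "1 \<le> k" "\<omega> \<in> space M"
  shows "z (Suc k) \<omega> = z_next k (\<omega>, \<xi> k \<omega>)"
  using resolvent_map_eq[OF G_mono less_imp_le[OF \<tau>_pos] z_step[OF assms]]
  by (simp add: z_next_def)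

lemma measurable_z_next:
  assumes [measurable]: "z k \<in> borel_measurable N" "w k \<in> borel_measurable N" "w (k - 1) \<in> borel_measurable N"
  shows "z_next k \<in> borel_measurable (N \<Otimes>\<^sub>M Q)"
proof -
  note [measurable] = borel_measurable_resolvent_map[OF G \<tau>_pos]
  show ?thesis
    unfolding z_next_def by measurable
qed

lemma measurable_z_Suc:
  assumes k: "1 \<le> k" and N: "space N = space M"
    and [measurable]: "z k \<in> borel_measurable N" "w k \<in> borel_measurable N" "w (k - 1) \<in> borel_measurable N"
      "\<xi> k \<in> measurable N Q"
  shows "z (Suc k) \<in> borel_measurable N"
proof -
  note [measurable] = measurable_z_next[of k N]
  have "(\<lambda>\<omega>. z_next k (\<omega>, \<xi> k \<omega>)) \<in> borel_measurable N"
    by measurable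
  also have "?this \<longleftrightarrow> ?thesis"
    using z_step_eq[OF k] N by (intro measurable_cong) simp
  finally show ?thesis .
qed

lemma measurable_init:
  assumes "space N = space M" "i \<le> 1"
  shows "z i \<in> borel_measurable N" "w i \<in> borel_measurable N"
proof -
  have i: "i = 0 \<or> i = Suc 0" using assms(2) by auto
  have "z i \<in> borel_measurable N \<longleftrightarrow> (\<lambda>_. z\<^sub>0) \<in> borel_measurable N"
    using i init assms(1) by (intro measurable_cong) auto
  then show "z i \<in> borel_measurable N" by simp
  have "w i \<in> borel_measurable N \<longleftrightarrow> (\<lambda>_. z\<^sub>0) \<in> borel_measurable N"
    using i init assms(1) by (intro measurable_cong) auto
  then show "w i \<in> borel_measurable N" by simp
qed

abbreviation draw :: "nat \<Rightarrow> 'w \<Rightarrow> 'x \<times> bool" where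
  "draw k \<omega> \<equiv> (\<xi> k \<omega>, c k \<omega>)"

lemma indep_draw: "indep_vars (\<lambda>_. Q \<Otimes>\<^sub>M count_space UNIV) draw {1..}"
  using draws by (simp add: independent_draws_def)

lemma distr_draw:
  "1 \<le> k \<Longrightarrow> distr M (Q \<Otimes>\<^sub>M count_space UNIV) (draw k) = Q \<Otimes>\<^sub>M measure_pmf (bernoulli_pmf p)"
  using draws by (simp add: independent_draws_def)

lemma measurable_draw: "1 \<le> k \<Longrightarrow> draw k \<in> measurable M (Q \<Otimes>\<^sub>M count_space UNIV)"
  using indep_draw by (auto simp: indep_vars_def)

lemma measurable_sample: "1 \<le> k \<Longrightarrow> \<xi> k \<in> measurable M Q"
  using measurable_compose[OF measurable_draw measurable_fst] by simp

lemma space_past[simp]: "space (\<P> k) = space M"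
  by (simp add: past_def space_measure_of_conv)

lemma sets_past:
  "sets (\<P> k) = sigma_sets (space M)
     ((\<Union>i\<in>{1..<k}. {\<xi> i -` A \<inter> space M | A. A \<in> sets Q}) \<union>
      (\<Union>i\<in>{1..k}. {w i -` A \<inter> space M | A. A \<in> sets borel}))"
  unfolding past_def by (rule sets_measure_of) auto

lemma past_sample:
  assumes "1 \<le> i" "i < k"
  shows "\<xi> i \<in> measurable (\<P> k) Q"
proof (rule measurableI)
  fix A assume "A \<in> sets Q"
  then have "\<xi> i -` A \<inter> space M \<in> (\<Union>i\<in>{1..<k}. {\<xi> i -` A \<inter> space M | A. A \<in> sets Q})"
    using assms by (intro UN_I[of i]) auto
  then show "\<xi> i -` A \<inter> space (\<P> k) \<in> sets (\<P> k)"
    unfolding sets_past space_past by (intro sigma_sets.Basic UnI1)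
qed (use measurable_space[OF measurable_sample[OF assms(1)]] in auto)

lemma past_w:
  assumes "i \<le> k"
  shows "w i \<in> borel_measurable (\<P> k)"
proof (cases "i = 0")
  case False
  show ?thesis
  proof (rule measurableI)
    fix A :: "'z set" assume "A \<in> sets borel"
    then have "w i -` A \<inter> space M \<in> (\<Union>i\<in>{1..k}. {w i -` A \<inter> space M | A. A \<in> sets borel})"
      using assms False by (intro UN_I[of i]) auto
    then show "w i -` A \<inter> space (\<P> k) \<in> sets (\<P> k)"
      unfolding sets_past space_past by (intro sigma_sets.Basic UnI2)
  qed simp
qed (simp add: measurable_init)

text \<open>The past is generated by samples and anchor points \<open>w\<^sub>i\<close> only. The iterates are measurable because
  each is a function of the previous iterate, two anchor points and one earlier sample.\<close>

lemma past_z: "i \<le> k \<Longrightarrow> z i \<in> borel_measurable (\<P> k)"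
proof (induction i)
  case (Suc i)
  then show ?case
    by (cases "i = 0") (auto simp: measurable_init past_w past_sample intro!: measurable_z_Suc)
qed (simp add: measurable_init)

lemma past_mono: "sets (\<P> k) \<subseteq> sets (\<P> (Suc k))"
  unfolding sets_past by (intro sigma_sets_subseteq Un_mono UN_mono) auto

text \<open>The past does not contain the coins, but the anchor points depend on them. So its independence
  of the current draw is derived from a larger sigma-algebra, generated by samples and coins.\<close>

definition history :: "nat \<Rightarrow> 'w measure" where
  "history k = vimage_algebra (space M) (\<lambda>\<omega>. restrict (\<lambda>i. draw i \<omega>) {1..<k})
     (PiM {1..<k} (\<lambda>_. Q \<Otimes>\<^sub>M count_space UNIV))"

lemma space_history[simp]: "space (history k) = space M"
  by (simp add: history_def)

lemma history_draw:
  assumes "1 \<le> i" "i < k"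
  shows "draw i \<in> measurable (history k) (Q \<Otimes>\<^sub>M count_space UNIV)"
proof -
  have "(\<lambda>\<omega>. restrict (\<lambda>i. draw i \<omega>) {1..<k}) \<in> measurable (history k) (PiM {1..<k} (\<lambda>_. Q \<Otimes>\<^sub>M count_space UNIV))"
    unfolding history_def
    by (rule measurable_vimage_algebra1) (auto simp: space_PiM measurable_space[OF measurable_draw] PiE_def)
  then have "(\<lambda>\<omega>. restrict (\<lambda>i. draw i \<omega>) {1..<k} i) \<in> measurable (history k) (Q \<Otimes>\<^sub>M count_space UNIV)"
    by (rule measurable_compose) (use assms in simp)
  then show ?thesis
    using assms by simp
qed

lemma history_sample: "1 \<le> i \<Longrightarrow> i < k \<Longrightarrow> \<xi> i \<in> measurable (history k) Q"
  using measurable_compose[OF history_draw measurable_fst] by simp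

lemma history_coin: "1 \<le> i \<Longrightarrow> i < k \<Longrightarrow> c i \<in> measurable (history k) (count_space UNIV)"
  using measurable_compose[OF history_draw measurable_snd] by simp

lemma history_iterates:
  "i \<le> k \<Longrightarrow> z i \<in> borel_measurable (history k) \<and> w i \<in> borel_measurable (history k)"
proof (induction i rule: less_induct)
  case (less i)
  show ?case
  proof (cases "i \<le> 1")
    case False
    then obtain j where j: "i = Suc j" "1 \<le> j"
      by (cases i) auto
    have IH[measurable]: "z j \<in> borel_measurable (history k)" "w j \<in> borel_measurable (history k)"
      "w (j - 1) \<in> borel_measurable (history k)"
      using less.IH[of j] less.IH[of "j - 1"] less.prems j by simp_all
    have s: "\<xi> j \<in> measurable (history k) Q" and [measurable]: "c j \<in> measurable (history k) (count_space UNIV)"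
      using less.prems j by (auto intro: history_sample history_coin)
    have z[measurable]: "z (Suc j) \<in> borel_measurable (history k)"
      using j IH s by (intro measurable_z_Suc) auto
    have "(\<lambda>\<omega>. if c j \<omega> then z (Suc j) \<omega> else w j \<omega>) \<in> borel_measurable (history k)"
      by measurable
    also have "?this \<longleftrightarrow> w (Suc j) \<in> borel_measurable (history k)"
      using w_step[OF j(2)] by (intro measurable_cong) simp
    finally show ?thesis
      using z j by simp
  next
    case True
    then show ?thesis
      using measurable_init[OF space_history] by blast
  qed
qed

lemma past_subset_history: "sets (\<P> k) \<subseteq> sets (history k)"
proof -
  have "\<xi> i -` A \<inter> space M \<in> sets (history k)" if "i \<in> {1..<k}" "A \<in> sets Q" for i A
    using measurable_sets[OF history_sample[of i k] that(2)] that(1) by simp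
  moreover have "w i -` A \<inter> space M \<in> sets (history k)" if "i \<in> {1..k}" "A \<in> sets borel" for i A
    using measurable_sets[of "w i" "history k" borel A] history_iterates[of i k] that by simp
  ultimately have "(\<Union>i\<in>{1..<k}. {\<xi> i -` A \<inter> space M | A. A \<in> sets Q}) \<union>
      (\<Union>i\<in>{1..k}. {w i -` A \<inter> space M | A. A \<in> sets borel}) \<subseteq> sets (history k)"
    by blast
  from sets.sigma_sets_subset[OF this] show ?thesis
    unfolding sets_past space_history .
qed

lemma subalgebra_past: "1 \<le> k \<Longrightarrow> subalgebra M (\<P> k)"
  and joint_past_draw: "1 \<le> k \<Longrightarrow>
    distr M (\<P> k \<Otimes>\<^sub>M (Q \<Otimes>\<^sub>M count_space UNIV)) (\<lambda>\<omega>. (\<omega>, draw k \<omega>)) =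
      distr M (\<P> k) (\<lambda>\<omega>. \<omega>) \<Otimes>\<^sub>M distr M (Q \<Otimes>\<^sub>M count_space UNIV) (draw k)"
proof -
  assume k: "1 \<le> k"
  note * = joint_distr_history[where N = "\<P> k" and k = k and J = "{1..<k}", OF indep_draw _ _ _ space_past
      past_subset_history[unfolded history_def]]
  show "subalgebra M (\<P> k)"
    by (rule *(1)) (use k in auto)
  show "distr M (\<P> k \<Otimes>\<^sub>M (Q \<Otimes>\<^sub>M count_space UNIV)) (\<lambda>\<omega>. (\<omega>, draw k \<omega>)) =
      distr M (\<P> k) (\<lambda>\<omega>. \<omega>) \<Otimes>\<^sub>M distr M (Q \<Otimes>\<^sub>M count_space UNIV) (draw k)"
    by (rule *(2)) (use k in auto)
qed

lemma measurable_iterates[measurable]: "z k \<in> borel_measurable M" "w k \<in> borel_measurable M"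
  by (rule measurable_from_subalg[OF subalgebra_past past_z, of "Suc k"], simp, simp)
    (rule measurable_from_subalg[OF subalgebra_past past_w, of "Suc k"], simp, simp)

lemma distr_draw_law_fst: "distr (Q \<Otimes>\<^sub>M measure_pmf (bernoulli_pmf p)) Q fst = Q"
  by (rule prob_space.distr_pair_fst) (rule prob_space_measure_pmf)

lemma nn_integral_freeze_sample:
  assumes k: "1 \<le> k" and h[measurable]: "h \<in> borel_measurable (\<P> k \<Otimes>\<^sub>M Q)"
  shows "(\<integral>\<^sup>+\<omega>. h (\<omega>, \<xi> k \<omega>) \<partial>M) = (\<integral>\<^sup>+\<omega>. (\<integral>\<^sup>+s. h (\<omega>, s) \<partial>Q) \<partial>M)"
proof -
  have "(\<integral>\<^sup>+\<omega>. h (\<omega>, \<xi> k \<omega>) \<partial>M) =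
      (\<integral>\<^sup>+\<omega>. (\<integral>\<^sup>+y. h (\<omega>, fst y) \<partial>(Q \<Otimes>\<^sub>M measure_pmf (bernoulli_pmf p))) \<partial>M)"
    using nn_integral_freezing[OF subalgebra_past[OF k] measurable_draw[OF k] joint_past_draw[OF k],
        of "\<lambda>(\<omega>, y). h (\<omega>, fst y)"]
    by (simp add: distr_draw[OF k])
  also have "\<dots> = (\<integral>\<^sup>+\<omega>. (\<integral>\<^sup>+s. h (\<omega>, s) \<partial>Q) \<partial>M)"
  proof (rule nn_integral_cong)
    fix \<omega> assume "\<omega> \<in> space M"
    then have [measurable]: "(\<lambda>s. h (\<omega>, s)) \<in> borel_measurable Q"
      by (intro measurable_compose[OF measurable_Pair1' h]) simp
    have "(\<integral>\<^sup>+s. h (\<omega>, s) \<partial>Q) = (\<integral>\<^sup>+s. h (\<omega>, s) \<partial>distr (Q \<Otimes>\<^sub>M measure_pmf (bernoulli_pmf p)) Q fst)"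
      by (simp only: distr_draw_law_fst)
    also have "\<dots> = (\<integral>\<^sup>+y. h (\<omega>, fst y) \<partial>(Q \<Otimes>\<^sub>M measure_pmf (bernoulli_pmf p)))"
      by (rule nn_integral_distr) auto
    finally show "(\<integral>\<^sup>+y. h (\<omega>, fst y) \<partial>(Q \<Otimes>\<^sub>M measure_pmf (bernoulli_pmf p))) = (\<integral>\<^sup>+s. h (\<omega>, s) \<partial>Q)" ..
  qed
  finally show ?thesis .
qed

lemma integral_freeze_sample:
  fixes h :: "_ \<Rightarrow> real"
  assumes k: "1 \<le> k" and h[measurable]: "h \<in> borel_measurable (\<P> k \<Otimes>\<^sub>M Q)"
    and int: "integrable M (\<lambda>\<omega>. h (\<omega>, \<xi> k \<omega>))"
  shows "(\<integral>\<omega>. h (\<omega>, \<xi> k \<omega>) \<partial>M) = (\<integral>\<omega>. (\<integral>s. h (\<omega>, s) \<partial>Q) \<partial>M)"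
proof -
  have "(\<integral>\<omega>. h (\<omega>, \<xi> k \<omega>) \<partial>M) =
      (\<integral>\<omega>. (\<integral>y. h (\<omega>, fst y) \<partial>(Q \<Otimes>\<^sub>M measure_pmf (bernoulli_pmf p))) \<partial>M)"
    using integral_freezing[OF subalgebra_past[OF k] measurable_draw[OF k] joint_past_draw[OF k],
        of "\<lambda>(\<omega>, y). h (\<omega>, fst y)"] int
    by (simp add: distr_draw[OF k])
  also have "\<dots> = (\<integral>\<omega>. (\<integral>s. h (\<omega>, s) \<partial>Q) \<partial>M)"
  proof (rule Bochner_Integration.integral_cong[OF refl])
    fix \<omega> assume "\<omega> \<in> space M"
    then have [measurable]: "(\<lambda>s. h (\<omega>, s)) \<in> borel_measurable Q"
      by (intro measurable_compose[OF measurable_Pair1' h]) simp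
    have "(\<integral>s. h (\<omega>, s) \<partial>Q) = (\<integral>s. h (\<omega>, s) \<partial>distr (Q \<Otimes>\<^sub>M measure_pmf (bernoulli_pmf p)) Q fst)"
      by (simp only: distr_draw_law_fst)
    also have "\<dots> = (\<integral>y. h (\<omega>, fst y) \<partial>(Q \<Otimes>\<^sub>M measure_pmf (bernoulli_pmf p)))"
      by (rule integral_distr) auto
    finally show "(\<integral>y. h (\<omega>, fst y) \<partial>(Q \<Otimes>\<^sub>M measure_pmf (bernoulli_pmf p))) = (\<integral>s. h (\<omega>, s) \<partial>Q)" ..
  qed
  finally show ?thesis .
qed

text \<open>The coin is independent of the past and the current sample together, since the draw has a product law.\<close>

lemma nn_integral_freeze_coin:
  assumes k: "1 \<le> k" and h[measurable]: "h \<in> borel_measurable (\<P> k \<Otimes>\<^sub>M Q)"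
    and g[measurable]: "g \<in> borel_measurable (\<P> k \<Otimes>\<^sub>M Q)"
  shows "(\<integral>\<^sup>+\<omega>. (if c k \<omega> then h (\<omega>, \<xi> k \<omega>) else g (\<omega>, \<xi> k \<omega>)) \<partial>M) =
    ennreal p * (\<integral>\<^sup>+\<omega>. h (\<omega>, \<xi> k \<omega>) \<partial>M) + ennreal (1 - p) * (\<integral>\<^sup>+\<omega>. g (\<omega>, \<xi> k \<omega>) \<partial>M)"
proof -
  let ?B = "measure_pmf (bernoulli_pmf p)"
  have [measurable_cong]: "sets ?B = sets (count_space UNIV)" by simp
  have [measurable]: "(\<lambda>\<omega>. \<integral>\<^sup>+s. h (\<omega>, s) \<partial>Q) \<in> borel_measurable M" "(\<lambda>\<omega>. \<integral>\<^sup>+s. g (\<omega>, s) \<partial>Q) \<in> borel_measurable M"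
    using measurable_from_subalg[OF subalgebra_past[OF k] Q.borel_measurable_nn_integral_fst[OF h]]
      measurable_from_subalg[OF subalgebra_past[OF k] Q.borel_measurable_nn_integral_fst[OF g]]
    by auto
  have "(\<integral>\<^sup>+\<omega>. (if c k \<omega> then h (\<omega>, \<xi> k \<omega>) else g (\<omega>, \<xi> k \<omega>)) \<partial>M) =
      (\<integral>\<^sup>+\<omega>. (\<integral>\<^sup>+y. (if snd y then h (\<omega>, fst y) else g (\<omega>, fst y)) \<partial>(Q \<Otimes>\<^sub>M ?B)) \<partial>M)"
    using nn_integral_freezing[OF subalgebra_past[OF k] measurable_draw[OF k] joint_past_draw[OF k],
        of "\<lambda>(\<omega>, y). if snd y then h (\<omega>, fst y) else g (\<omega>, fst y)"]
    by (simp add: distr_draw[OF k] cong: if_cong)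
  also have "\<dots> = (\<integral>\<^sup>+\<omega>. (ennreal p * (\<integral>\<^sup>+s. h (\<omega>, s) \<partial>Q) + ennreal (1 - p) * (\<integral>\<^sup>+s. g (\<omega>, s) \<partial>Q)) \<partial>M)"
  proof (rule nn_integral_cong)
    fix \<omega> assume "\<omega> \<in> space M"
    then have [measurable]: "(\<lambda>s. h (\<omega>, s)) \<in> borel_measurable Q" "(\<lambda>s. g (\<omega>, s)) \<in> borel_measurable Q"
      by (auto intro!: measurable_compose[OF measurable_Pair1' h] measurable_compose[OF measurable_Pair1' g])
    have "(\<integral>\<^sup>+y. (if snd y then h (\<omega>, fst y) else g (\<omega>, fst y)) \<partial>(Q \<Otimes>\<^sub>M ?B)) =
        (\<integral>\<^sup>+s. (\<integral>\<^sup>+b. (if b then h (\<omega>, s) else g (\<omega>, s)) \<partial>?B) \<partial>Q)"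
      by (subst measure_pmf.nn_integral_fst[symmetric]) (auto cong: if_cong)
    also have "\<dots> = (\<integral>\<^sup>+s. (ennreal p * h (\<omega>, s) + ennreal (1 - p) * g (\<omega>, s)) \<partial>Q)"
      using p by (simp add: mult.commute)
    also have "\<dots> = ennreal p * (\<integral>\<^sup>+s. h (\<omega>, s) \<partial>Q) + ennreal (1 - p) * (\<integral>\<^sup>+s. g (\<omega>, s) \<partial>Q)"
      by (simp add: nn_integral_add nn_integral_cmult)
    finally show "(\<integral>\<^sup>+y. (if snd y then h (\<omega>, fst y) else g (\<omega>, fst y)) \<partial>(Q \<Otimes>\<^sub>M ?B)) = \<dots>" .
  qed
  also have "\<dots> = ennreal p * (\<integral>\<^sup>+\<omega>. (\<integral>\<^sup>+s. h (\<omega>, s) \<partial>Q) \<partial>M) + ennreal (1 - p) * (\<integral>\<^sup>+\<omega>. (\<integral>\<^sup>+s. g (\<omega>, s) \<partial>Q) \<partial>M)"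
    by (simp add: nn_integral_add nn_integral_cmult)
  finally show ?thesis
    by (simp add: nn_integral_freeze_sample[OF k])
qed

section \<open>Square integrability and the Lyapunov function\<close>

lemma past_events: "1 \<le> k \<Longrightarrow> A \<in> sets (\<P> k) \<Longrightarrow> A \<in> events"
  using subalgebra_past by (auto simp: subalgebra_def)

lemma measurable_noise[measurable]: "1 \<le> k \<Longrightarrow> \<Delta> k \<in> borel_measurable M"
  using measurable_sample[of k] by measurable

text \<open>Freezing the past in the Lipschitz condition of the stochastic operator.\<close>

lemma noise_integrable:
  assumes k: "1 \<le> k" and int: "integrable M (\<lambda>\<omega>. (norm (z k \<omega> - w (k - 1) \<omega>))\<^sup>2)"
  shows "integrable M (\<lambda>\<omega>. (norm (\<Delta> k \<omega>))\<^sup>2)"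
    and "A \<in> sets (\<P> k) \<Longrightarrow>
      (\<integral>\<omega>\<in>A. (norm (\<Delta> k \<omega>))\<^sup>2 \<partial>M) \<le> L\<^sup>2 * (\<integral>\<omega>\<in>A. (norm (z k \<omega> - w (k - 1) \<omega>))\<^sup>2 \<partial>M)"
proof -
  note [measurable] = past_z[of k k] past_w[of "k - 1" k] measurable_noise[OF k]
  have bound: "(\<integral>\<^sup>+\<omega>. indicator A \<omega> * ennreal ((norm (\<Delta> k \<omega>))\<^sup>2) \<partial>M) \<le>
      ennreal (L\<^sup>2 * (\<integral>\<omega>\<in>A. (norm (z k \<omega> - w (k - 1) \<omega>))\<^sup>2 \<partial>M))"
    if A[measurable]: "A \<in> sets (\<P> k)" for A
  proof -
    let ?h = "\<lambda>(\<omega>, s). indicator A \<omega> * ennreal ((norm (Fo s (z k \<omega>) - Fo s (w (k - 1) \<omega>)))\<^sup>2)"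
    have h: "?h \<in> borel_measurable (\<P> k \<Otimes>\<^sub>M Q)"
      by measurable
    have "(\<integral>\<^sup>+\<omega>. indicator A \<omega> * ennreal ((norm (\<Delta> k \<omega>))\<^sup>2) \<partial>M) =
        (\<integral>\<^sup>+\<omega>. \<integral>\<^sup>+s. indicator A \<omega> * ennreal ((norm (Fo s (z k \<omega>) - Fo s (w (k - 1) \<omega>)))\<^sup>2) \<partial>Q \<partial>M)"
      using nn_integral_freeze_sample[OF k h] by simp
    also have "\<dots> = (\<integral>\<^sup>+\<omega>. indicator A \<omega> * (\<integral>\<^sup>+s. ennreal ((norm (Fo s (z k \<omega>) - Fo s (w (k - 1) \<omega>)))\<^sup>2) \<partial>Q) \<partial>M)"
      by (intro nn_integral_cong nn_integral_cmult) measurable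
    also have "\<dots> \<le> (\<integral>\<^sup>+\<omega>. indicator A \<omega> * ennreal (L\<^sup>2 * (norm (z k \<omega> - w (k - 1) \<omega>))\<^sup>2) \<partial>M)"
      by (intro nn_integral_mono mult_left_mono oracle_second_moment) simp
    also have "\<dots> = ennreal (\<integral>\<omega>\<in>A. L\<^sup>2 * (norm (z k \<omega> - w (k - 1) \<omega>))\<^sup>2 \<partial>M)"
      using int by (intro nn_integral_indicator_eq_set_integral past_events[OF k A]) auto
    also have "\<dots> = ennreal (L\<^sup>2 * (\<integral>\<omega>\<in>A. (norm (z k \<omega> - w (k - 1) \<omega>))\<^sup>2 \<partial>M))"
      by simp
    finally show ?thesis .
  qed
  show int': "integrable M (\<lambda>\<omega>. (norm (\<Delta> k \<omega>))\<^sup>2)"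
  proof (rule integrableI_bounded)
    have "space M \<in> sets (\<P> k)"
      using sets.top[of "\<P> k"] by simp
    from bound[OF this]
    have "(\<integral>\<^sup>+\<omega>. ennreal (norm ((norm (\<Delta> k \<omega>))\<^sup>2)) \<partial>M) \<le>
        ennreal (L\<^sup>2 * (\<integral>\<omega>\<in>space M. (norm (z k \<omega> - w (k - 1) \<omega>))\<^sup>2 \<partial>M))"
      by (simp cong: nn_integral_cong_simp)
    then show "(\<integral>\<^sup>+\<omega>. ennreal (norm ((norm (\<Delta> k \<omega>))\<^sup>2)) \<partial>M) < \<infinity>"
      by (rule le_less_trans) simp
  qed measurable
  show "(\<integral>\<omega>\<in>A. (norm (\<Delta> k \<omega>))\<^sup>2 \<partial>M) \<le> L\<^sup>2 * (\<integral>\<omega>\<in>A. (norm (z k \<omega> - w (k - 1) \<omega>))\<^sup>2 \<partial>M)"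
    if A: "A \<in> sets (\<P> k)"
  proof -
    have "0 \<le> (\<integral>\<omega>\<in>A. (norm (z k \<omega> - w (k - 1) \<omega>))\<^sup>2 \<partial>M)"
      by (simp add: set_lebesgue_integral_def)
    then show ?thesis
      using bound[OF A] nn_integral_indicator_eq_set_integral[OF past_events[OF k A] int']
      by simp
  qed
qed

text \<open>Induction along the iteration. A solution is a fixed point of the resolvent step without noise,
  so nonexpansiveness bounds \<open>\<parallel>z\<^sub>k\<^sub>+\<^sub>1 - zs\<parallel>\<close> by distances at time \<open>k\<close> and the increment, whose second
  moment is finite by the previous lemma.\<close>

lemma square_integrable:
  assumes zs: "zs \<in> Sol F G"
  shows "integrable M (\<lambda>\<omega>. (norm (z k \<omega> - zs))\<^sup>2) \<and> integrable M (\<lambda>\<omega>. (norm (w k \<omega> - zs))\<^sup>2)"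
proof (induction k rule: less_induct)
  case (less k)
  show ?case
  proof (cases "k \<le> 1")
    case True
    then have "k = 0 \<or> k = Suc 0" by auto
    then have eq: "\<omega> \<in> space M \<Longrightarrow> z k \<omega> = z\<^sub>0" "\<omega> \<in> space M \<Longrightarrow> w k \<omega> = z\<^sub>0" for \<omega>
      using init by auto
    have "integrable M (\<lambda>\<omega>. (norm (z k \<omega> - zs))\<^sup>2) \<longleftrightarrow> integrable M (\<lambda>\<omega>. (norm (z\<^sub>0 - zs))\<^sup>2)"
      "integrable M (\<lambda>\<omega>. (norm (w k \<omega> - zs))\<^sup>2) \<longleftrightarrow> integrable M (\<lambda>\<omega>. (norm (z\<^sub>0 - zs))\<^sup>2)"
      by (intro Bochner_Integration.integrable_cong; simp add: eq)+
    then show ?thesis by simp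
  next
    case False
    then obtain j where j: "k = Suc j" "1 \<le> j"
      by (cases k) auto
    have int: "integrable M (\<lambda>\<omega>. (norm (z j \<omega> - zs))\<^sup>2)" "integrable M (\<lambda>\<omega>. (norm (w j \<omega> - zs))\<^sup>2)"
      "integrable M (\<lambda>\<omega>. (norm (w (j - 1) \<omega> - zs))\<^sup>2)"
      using less[of j] less[of "j - 1"] j by simp_all
    have "integrable M (\<lambda>\<omega>. (norm (z j \<omega> - w (j - 1) \<omega>))\<^sup>2)"
    proof (rule Bochner_Integration.integrable_bound)
      show "integrable M (\<lambda>\<omega>. 2 * (norm (z j \<omega> - zs))\<^sup>2 + 2 * (norm (w (j - 1) \<omega> - zs))\<^sup>2)"
        using int by simp
    qed (auto simp: norm_diff_squared_le)
    note noise = noise_integrable(1)[OF j(2) this]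
    let ?B = "\<lambda>\<omega>. 4 * ((norm (z j \<omega> - zs))\<^sup>2 + (norm (w j \<omega> - zs))\<^sup>2 +
        (\<tau> * L * norm (w j \<omega> - zs))\<^sup>2 + (\<tau> * norm (\<Delta> j \<omega>))\<^sup>2)"
    have B: "integrable M ?B"
      using int noise by (simp add: power_mult_distrib)
    have fix_zs: "zs \<in> resolvent (op_scale \<tau> G) (zs - \<tau> *\<^sub>R F zs)"
      using zs by (auto simp: resolvent_op_scale_iff Sol_iff intro!: bexI[of _ "- F zs"])
    have bound: "(norm (z k \<omega> - zs))\<^sup>2 \<le> ?B \<omega>" if \<omega>: "\<omega> \<in> space M" for \<omega>
    proof -
      define u where "u = \<alpha> *\<^sub>R (z j \<omega> - zs)"
      define v where "v = (1 - \<alpha>) *\<^sub>R (w j \<omega> - zs)"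
      define f where "f = \<tau> *\<^sub>R (F (w j \<omega>) - F zs)"
      have "norm (z k \<omega> - zs) \<le> norm (u + v - f - \<tau> *\<^sub>R \<Delta> j \<omega>)"
        using resolvent_nonexpansive[OF G_mono less_imp_le[OF \<tau>_pos] z_step[OF j(2) \<omega>] fix_zs]
        by (simp add: j(1) u_def v_def f_def algebra_simps)
      also have "\<dots> \<le> norm u + norm v + norm f + norm (\<tau> *\<^sub>R \<Delta> j \<omega>)"
        using norm_triangle_ineq4[of "u + v - f" "\<tau> *\<^sub>R \<Delta> j \<omega>"] norm_triangle_ineq4[of "u + v" f]
          norm_triangle_ineq[of u v] by linarith
      also have "\<dots> \<le> norm (z j \<omega> - zs) + norm (w j \<omega> - zs) + \<tau> * L * norm (w j \<omega> - zs) + \<tau> * norm (\<Delta> j \<omega>)"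
      proof (intro add_mono)
        show "norm u \<le> norm (z j \<omega> - zs)" "norm v \<le> norm (w j \<omega> - zs)"
          using \<alpha> by (auto simp: u_def v_def intro!: mult_left_le_one_le)
        show "norm f \<le> \<tau> * L * norm (w j \<omega> - zs)"
          using \<tau>_pos lipschitz by (simp add: f_def mult.assoc)
        show "norm (\<tau> *\<^sub>R \<Delta> j \<omega>) \<le> \<tau> * norm (\<Delta> j \<omega>)"
          using \<tau>_pos by simp
      qed
      finally have "(norm (z k \<omega> - zs))\<^sup>2 \<le> \<dots>\<^sup>2"
        by (intro power_mono) simp_all
      then show ?thesis
        using sum4_squared_le order_trans by blast
    qed
    have z: "integrable M (\<lambda>\<omega>. (norm (z k \<omega> - zs))\<^sup>2)"
      by (rule Bochner_Integration.integrable_bound[OF B]) (auto intro!: AE_I2 order_trans[OF bound])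
    have "integrable M (\<lambda>\<omega>. (norm (w k \<omega> - zs))\<^sup>2)"
    proof (rule Bochner_Integration.integrable_bound)
      show "integrable M (\<lambda>\<omega>. (norm (z k \<omega> - zs))\<^sup>2 + (norm (w j \<omega> - zs))\<^sup>2)"
        using z int by simp
      show "AE \<omega> in M. norm ((norm (w k \<omega> - zs))\<^sup>2) \<le> norm ((norm (z k \<omega> - zs))\<^sup>2 + (norm (w j \<omega> - zs))\<^sup>2)"
        using w_step[OF j(2)] j(1) by (intro AE_I2) auto
    qed simp
    with z show ?thesis by blast
  qed
qed

lemma gap_integrable: "integrable M (\<lambda>\<omega>. (norm (z i \<omega> - w j \<omega>))\<^sup>2)"
  and step_integrable: "integrable M (\<lambda>\<omega>. (norm (z i \<omega> - z j \<omega>))\<^sup>2)"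
proof -
  obtain zs where zs: "zs \<in> Sol F G" using sol by blast
  note int = square_integrable[OF zs]
  show "integrable M (\<lambda>\<omega>. (norm (z i \<omega> - w j \<omega>))\<^sup>2)"
    by (rule Bochner_Integration.integrable_bound
        [of _ "\<lambda>\<omega>. 2 * (norm (z i \<omega> - zs))\<^sup>2 + 2 * (norm (w j \<omega> - zs))\<^sup>2"])
      (auto simp: int norm_diff_squared_le)
  show "integrable M (\<lambda>\<omega>. (norm (z i \<omega> - z j \<omega>))\<^sup>2)"
    by (rule Bochner_Integration.integrable_bound
        [of _ "\<lambda>\<omega>. 2 * (norm (z i \<omega> - zs))\<^sup>2 + 2 * (norm (z j \<omega> - zs))\<^sup>2"])
      (auto simp: int norm_diff_squared_le)
qed

lemma product_integrable:
  fixes f g :: "'w \<Rightarrow> 'z"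
  assumes [measurable]: "f \<in> borel_measurable M" "g \<in> borel_measurable M"
    and "integrable M (\<lambda>\<omega>. (norm (f \<omega>))\<^sup>2)" "integrable M (\<lambda>\<omega>. (norm (g \<omega>))\<^sup>2)"
  shows "integrable M (\<lambda>\<omega>. f \<omega> \<bullet> g \<omega>)"
proof (rule Bochner_Integration.integrable_bound)
  show "integrable M (\<lambda>\<omega>. (norm (f \<omega>))\<^sup>2 + (norm (g \<omega>))\<^sup>2)"
    using assms by simp
  show "AE \<omega> in M. norm (f \<omega> \<bullet> g \<omega>) \<le> norm ((norm (f \<omega>))\<^sup>2 + (norm (g \<omega>))\<^sup>2)"
  proof (rule AE_I2)
    fix \<omega>
    have "2 * (norm (f \<omega>) * norm (g \<omega>)) \<le> (norm (f \<omega>))\<^sup>2 + (norm (g \<omega>))\<^sup>2"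
      using sum_squares_bound[of "norm (f \<omega>)" "norm (g \<omega>)"] by simp
    moreover have "\<bar>f \<omega> \<bullet> g \<omega>\<bar> \<le> norm (f \<omega>) * norm (g \<omega>)"
      by (rule Cauchy_Schwarz_ineq2)
    moreover have "0 \<le> norm (f \<omega>) * norm (g \<omega>)"
      by simp
    ultimately show "norm (f \<omega> \<bullet> g \<omega>) \<le> norm ((norm (f \<omega>))\<^sup>2 + (norm (g \<omega>))\<^sup>2)"
      unfolding real_norm_def by linarith
  qed
qed measurable

lemma cross_integrable:
  assumes zs: "zs \<in> Sol F G"
  shows "integrable M (\<lambda>\<omega>. (F (z i \<omega>) - F (w j \<omega>)) \<bullet> (zs - z i \<omega>))"
proof (rule product_integrable)
  show "integrable M (\<lambda>\<omega>. (norm (F (z i \<omega>) - F (w j \<omega>)))\<^sup>2)"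
  proof (rule Bochner_Integration.integrable_bound)
    show "integrable M (\<lambda>\<omega>. L\<^sup>2 * (norm (z i \<omega> - w j \<omega>))\<^sup>2)"
      using gap_integrable by simp
    show "AE \<omega> in M. norm ((norm (F (z i \<omega>) - F (w j \<omega>)))\<^sup>2) \<le> norm (L\<^sup>2 * (norm (z i \<omega> - w j \<omega>))\<^sup>2)"
      using power_mono[OF lipschitz norm_ge_zero, of _ _ 2] by (simp add: power_mult_distrib)
  qed measurable
  show "integrable M (\<lambda>\<omega>. (norm (zs - z i \<omega>))\<^sup>2)"
    using square_integrable[OF zs] by (simp add: norm_minus_commute)
qed measurable

lemma \<Phi>_integrable:
  assumes "zs \<in> Sol F G"
  shows "integrable M (\<Phi> F \<alpha> p \<tau> z w k zs)"
  unfolding \<Phi>_def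
  using square_integrable[OF assms] cross_integrable[OF assms] gap_integrable by simp

lemma \<Phi>_measurable_past: "\<Phi> F \<alpha> p \<tau> z w k zs \<in> borel_measurable (\<P> k)"
proof -
  note [measurable] = past_z[of k k] past_w[of k k] past_w[of "k - 1" k]
  show ?thesis
    unfolding \<Phi>_def by measurable
qed

text \<open>The cross term of \<open>\<Phi>\<close> is at most \<open>2 \<tau> L a b\<close> with \<open>a = \<parallel>z\<^sub>k - x\<parallel>\<close> and \<open>b = \<parallel>z\<^sub>k - w\<^sub>k\<^sub>-\<^sub>1\<parallel>\<close>. Since
  \<open>\<tau> L = \<gamma> sqrt (\<alpha> (1 - \<alpha>))\<close>, this is at most \<open>\<gamma> (\<alpha> a\<^sup>2 + (1 - \<alpha>) b\<^sup>2)\<close>.\<close>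

lemma \<Phi>_lower_bound:
  "(1 - \<gamma>) * (\<alpha> * (norm (z k \<omega> - x))\<^sup>2 + (1 - \<alpha>) * (norm (z k \<omega> - w (k - 1) \<omega>))\<^sup>2)
     + (1 - \<alpha>) / p * (norm (w k \<omega> - x))\<^sup>2 \<le> \<Phi> F \<alpha> p \<tau> z w k x \<omega>"
proof -
  define a where "a = norm (z k \<omega> - x)"
  define b where "b = norm (z k \<omega> - w (k - 1) \<omega>)"
  have "\<bar>(F (z k \<omega>) - F (w (k - 1) \<omega>)) \<bullet> (x - z k \<omega>)\<bar> \<le> (L * b) * a"
    using Cauchy_Schwarz_ineq2[of "F (z k \<omega>) - F (w (k - 1) \<omega>)" "x - z k \<omega>"]
      mult_right_mono[OF lipschitz[of "z k \<omega>" "w (k - 1) \<omega>"], of a]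
    by (simp add: a_def b_def norm_minus_commute)
  then have "- ((F (z k \<omega>) - F (w (k - 1) \<omega>)) \<bullet> (x - z k \<omega>)) \<le> L * b * a"
    by linarith
  then have "2 * \<tau> * (- ((F (z k \<omega>) - F (w (k - 1) \<omega>)) \<bullet> (x - z k \<omega>))) \<le> 2 * \<tau> * (L * b * a)"
    using \<tau>_pos by (intro mult_left_mono) auto
  also have "\<dots> = 2 * (\<tau> * L) * b * a"
    by simp
  also have "\<dots> = \<gamma> * (2 * (sqrt \<alpha> * a) * (sqrt (1 - \<alpha>) * b))"
    unfolding \<tau>_L real_sqrt_mult by simp
  also have "\<dots> \<le> \<gamma> * ((sqrt \<alpha> * a)\<^sup>2 + (sqrt (1 - \<alpha>) * b)\<^sup>2)"
    using \<gamma> by (intro mult_left_mono sum_squares_bound) auto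
  also have "\<dots> = \<gamma> * (\<alpha> * a\<^sup>2 + (1 - \<alpha>) * b\<^sup>2)"
    using \<alpha> by (simp add: power_mult_distrib)
  finally show ?thesis
    unfolding \<Phi>_def a_def[symmetric] b_def[symmetric] by (simp add: algebra_simps)
qed

lemma \<Phi>_nonneg: "0 \<le> \<Phi> F \<alpha> p \<tau> z w k x \<omega>"
proof -
  have "0 \<le> (1 - \<gamma>) * (\<alpha> * (norm (z k \<omega> - x))\<^sup>2 + (1 - \<alpha>) * (norm (z k \<omega> - w (k - 1) \<omega>))\<^sup>2)
     + (1 - \<alpha>) / p * (norm (w k \<omega> - x))\<^sup>2"
    using \<alpha> p \<gamma> by (intro add_nonneg_nonneg mult_nonneg_nonneg) auto
  then show ?thesis
    using \<Phi>_lower_bound order_trans by blast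
qed

section \<open>Expected decrease of the Lyapunov function\<close>

text \<open>The coin decides between \<open>z\<^sub>k\<^sub>+\<^sub>1\<close> and \<open>w\<^sub>k\<close> independently of both. The computation is done with
  nonnegative integrals, for which Fubini's theorem has no integrability condition.\<close>

lemma coin_average:
  assumes k: "1 \<le> k" and zs: "zs \<in> Sol F G" and A[measurable]: "A \<in> sets (\<P> k)"
  shows "(\<integral>\<omega>\<in>A. (norm (w (Suc k) \<omega> - zs))\<^sup>2 \<partial>M) =
    p * (\<integral>\<omega>\<in>A. (norm (z (Suc k) \<omega> - zs))\<^sup>2 \<partial>M) + (1 - p) * (\<integral>\<omega>\<in>A. (norm (w k \<omega> - zs))\<^sup>2 \<partial>M)"
proof -
  note [measurable] = past_z[of k k] past_w[of k k] past_w[of "k - 1" k]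
  note [measurable] = measurable_z_next[of k "\<P> k"]
  note int = square_integrable[OF zs]
  note conv = nn_integral_indicator_eq_set_integral[OF past_events[OF k A]]
  let ?h = "\<lambda>y. indicator A (fst y) * ennreal ((norm (z_next k y - zs))\<^sup>2)"
  let ?g = "\<lambda>y. indicator A (fst y) * ennreal ((norm (w k (fst y) - zs))\<^sup>2)"
  have h: "?h \<in> borel_measurable (\<P> k \<Otimes>\<^sub>M Q)"
    by measurable
  have g: "?g \<in> borel_measurable (\<P> k \<Otimes>\<^sub>M Q)"
    by measurable
  have "ennreal (\<integral>\<omega>\<in>A. (norm (w (Suc k) \<omega> - zs))\<^sup>2 \<partial>M) =
      (\<integral>\<^sup>+\<omega>. indicator A \<omega> * ennreal ((norm (w (Suc k) \<omega> - zs))\<^sup>2) \<partial>M)"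
    using int by (subst conv) auto
  also have "\<dots> = (\<integral>\<^sup>+\<omega>. (if c k \<omega> then ?h (\<omega>, \<xi> k \<omega>) else ?g (\<omega>, \<xi> k \<omega>)) \<partial>M)"
    by (intro nn_integral_cong) (auto simp: w_step[OF k] z_step_eq[OF k])
  also have "\<dots> = ennreal p * (\<integral>\<^sup>+\<omega>. ?h (\<omega>, \<xi> k \<omega>) \<partial>M) + ennreal (1 - p) * (\<integral>\<^sup>+\<omega>. ?g (\<omega>, \<xi> k \<omega>) \<partial>M)"
    by (rule nn_integral_freeze_coin[OF k h g])
  also have "(\<integral>\<^sup>+\<omega>. ?h (\<omega>, \<xi> k \<omega>) \<partial>M) =
      (\<integral>\<^sup>+\<omega>. indicator A \<omega> * ennreal ((norm (z (Suc k) \<omega> - zs))\<^sup>2) \<partial>M)"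
    by (intro nn_integral_cong) (simp add: z_step_eq[OF k])
  also have "\<dots> = ennreal (\<integral>\<omega>\<in>A. (norm (z (Suc k) \<omega> - zs))\<^sup>2 \<partial>M)"
    using int by (subst conv) auto
  also have "(\<integral>\<^sup>+\<omega>. ?g (\<omega>, \<xi> k \<omega>) \<partial>M) = ennreal (\<integral>\<omega>\<in>A. (norm (w k \<omega> - zs))\<^sup>2 \<partial>M)"
    using int by (simp add: conv)
  finally have eq: "ennreal (\<integral>\<omega>\<in>A. (norm (w (Suc k) \<omega> - zs))\<^sup>2 \<partial>M) =
      ennreal p * ennreal (\<integral>\<omega>\<in>A. (norm (z (Suc k) \<omega> - zs))\<^sup>2 \<partial>M)
      + ennreal (1 - p) * ennreal (\<integral>\<omega>\<in>A. (norm (w k \<omega> - zs))\<^sup>2 \<partial>M)" .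
  have nn: "0 \<le> (\<integral>\<omega>\<in>A. (norm (v \<omega> - zs))\<^sup>2 \<partial>M)" for v
    by (simp add: set_lebesgue_integral_def)
  have nn': "0 \<le> p * (\<integral>\<omega>\<in>A. (norm (z (Suc k) \<omega> - zs))\<^sup>2 \<partial>M)" "0 \<le> (1 - p) * (\<integral>\<omega>\<in>A. (norm (w k \<omega> - zs))\<^sup>2 \<partial>M)"
    using nn p by (auto intro: mult_nonneg_nonneg)
  have "ennreal (\<integral>\<omega>\<in>A. (norm (w (Suc k) \<omega> - zs))\<^sup>2 \<partial>M) = ennreal
      (p * (\<integral>\<omega>\<in>A. (norm (z (Suc k) \<omega> - zs))\<^sup>2 \<partial>M) + (1 - p) * (\<integral>\<omega>\<in>A. (norm (w k \<omega> - zs))\<^sup>2 \<partial>M))"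
    unfolding eq ennreal_plus[OF nn'] using p nn by (simp add: ennreal_mult')
  then show ?thesis
    using nn nn' by (subst (asm) ennreal_inj) auto
qed

text \<open>Unbiasedness applies because \<open>zs - z\<^sub>k\<close> is determined by the past; this is why the step estimate
  separates this inner product from the one with \<open>z\<^sub>k - z\<^sub>k\<^sub>+\<^sub>1\<close>.\<close>

lemma noise_average:
  assumes k: "1 \<le> k" and zs: "zs \<in> Sol F G" and A[measurable]: "A \<in> sets (\<P> k)"
  shows "integrable M (\<lambda>\<omega>. \<Delta> k \<omega> \<bullet> (zs - z k \<omega>))"
    and "(\<integral>\<omega>\<in>A. \<Delta> k \<omega> \<bullet> (zs - z k \<omega>) \<partial>M) =
      (\<integral>\<omega>\<in>A. (F (z k \<omega>) - F (w (k - 1) \<omega>)) \<bullet> (zs - z k \<omega>) \<partial>M)"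
proof -
  note [measurable] = past_z[of k k] past_w[of "k - 1" k]
  show int: "integrable M (\<lambda>\<omega>. \<Delta> k \<omega> \<bullet> (zs - z k \<omega>))"
    using noise_integrable(1)[OF k gap_integrable] square_integrable[OF zs] measurable_noise[OF k]
    by (intro product_integrable) (auto simp: norm_minus_commute)
  let ?h = "\<lambda>(\<omega>, s). indicator A \<omega> * ((Fo s (z k \<omega>) - Fo s (w (k - 1) \<omega>)) \<bullet> (zs - z k \<omega>))"
  have h: "?h \<in> borel_measurable (\<P> k \<Otimes>\<^sub>M Q)"
    by measurable
  have int_h: "integrable M (\<lambda>\<omega>. ?h (\<omega>, \<xi> k \<omega>))"
    using integrable_mult_indicator[OF past_events[OF k A] int] by simp
  have "(\<integral>\<omega>\<in>A. \<Delta> k \<omega> \<bullet> (zs - z k \<omega>) \<partial>M) =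
      (\<integral>\<omega>. \<integral>s. indicator A \<omega> * ((Fo s (z k \<omega>) - Fo s (w (k - 1) \<omega>)) \<bullet> (zs - z k \<omega>)) \<partial>Q \<partial>M)"
    using integral_freeze_sample[OF k h int_h] by (simp add: set_lebesgue_integral_def)
  also have "\<dots> = (\<integral>\<omega>\<in>A. (F (z k \<omega>) - F (w (k - 1) \<omega>)) \<bullet> (zs - z k \<omega>) \<partial>M)"
    using integral_oracle by (simp add: set_lebesgue_integral_def)
  finally show "(\<integral>\<omega>\<in>A. \<Delta> k \<omega> \<bullet> (zs - z k \<omega>) \<partial>M) =
      (\<integral>\<omega>\<in>A. (F (z k \<omega>) - F (w (k - 1) \<omega>)) \<bullet> (zs - z k \<omega>) \<partial>M)" .
qed

text \<open>The step estimate, integrated over an event of the past. In \<open>\<Phi>\<^sub>k\<^sub>+\<^sub>1\<close> the coin turns the weight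
  \<open>(1 - \<alpha>) / p\<close> of \<open>\<parallel>w\<^sub>k\<^sub>+\<^sub>1 - zs\<parallel>\<^sup>2\<close> into weight \<open>1 - \<alpha>\<close> on \<open>\<parallel>z\<^sub>k\<^sub>+\<^sub>1 - zs\<parallel>\<^sup>2\<close>, completing it to
  the full square on the left of the step estimate, and returns \<open>(1 - \<alpha>) / p\<close> minus the \<open>1 - \<alpha>\<close>
  which the step estimate has on \<open>\<parallel>w\<^sub>k - zs\<parallel>\<^sup>2\<close>.\<close>

lemma \<Phi>_drift:
  assumes k: "1 \<le> k" and zs: "zs \<in> Sol F G" and A: "A \<in> sets (\<P> k)"
  shows "(\<integral>\<omega>\<in>A. \<Phi> F \<alpha> p \<tau> z w (Suc k) zs \<omega> \<partial>M)
      + (1 - \<gamma>) * ((1 - \<alpha>) * (\<integral>\<omega>\<in>A. (norm (z k \<omega> - w (k - 1) \<omega>))\<^sup>2 \<partial>M)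
          + \<alpha> * (\<integral>\<omega>\<in>A. (norm (z (Suc k) \<omega> - z k \<omega>))\<^sup>2 \<partial>M))
    \<le> (\<integral>\<omega>\<in>A. \<Phi> F \<alpha> p \<tau> z w k zs \<omega> \<partial>M)"
proof -
  have A_M: "A \<in> events"
    using past_events[OF k A] .
  define I where "I f = (\<integral>\<omega>\<in>A. f \<omega> \<partial>M)" for f :: "'w \<Rightarrow> real"
  have I_int: "integrable M (\<lambda>\<omega>. indicator A \<omega> * f \<omega>)" if "integrable M f" for f :: "'w \<Rightarrow> real"
    using integrable_mult_indicator[OF A_M that] by simp
  have I_add: "I (\<lambda>\<omega>. f \<omega> + g \<omega>) = I f + I g" if "integrable M f" "integrable M g" for f g
    using I_int[OF that(1)] I_int[OF that(2)] by (simp add: I_def set_lebesgue_integral_def distrib_left)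
  have I_diff: "I (\<lambda>\<omega>. f \<omega> - g \<omega>) = I f - I g" if "integrable M f" "integrable M g" for f g
    using I_int[OF that(1)] I_int[OF that(2)] by (simp add: I_def set_lebesgue_integral_def right_diff_distrib)
  have I_mult: "I (\<lambda>\<omega>. a * f \<omega>) = a * I f" for a f
    by (simp add: I_def)
  have I_mono: "I f \<le> I g" if "integrable M f" "integrable M g" "\<And>\<omega>. \<omega> \<in> space M \<Longrightarrow> f \<omega> \<le> g \<omega>" for f g
    unfolding I_def set_lebesgue_integral_def
    using I_int[OF that(1)] I_int[OF that(2)] that(3)
    by (intro integral_mono) (auto split: split_indicator)
  define Z' where "Z' \<omega> = (norm (z (Suc k) \<omega> - zs))\<^sup>2" for \<omega>
  define W' where "W' \<omega> = (norm (w (Suc k) \<omega> - zs))\<^sup>2" for \<omega>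
  define C' where "C' \<omega> = (F (z (Suc k) \<omega>) - F (w k \<omega>)) \<bullet> (zs - z (Suc k) \<omega>)" for \<omega>
  define V' where "V' \<omega> = (norm (z (Suc k) \<omega> - w k \<omega>))\<^sup>2" for \<omega>
  define Z where "Z \<omega> = (norm (z k \<omega> - zs))\<^sup>2" for \<omega>
  define W where "W \<omega> = (norm (w k \<omega> - zs))\<^sup>2" for \<omega>
  define C where "C \<omega> = (F (z k \<omega>) - F (w (k - 1) \<omega>)) \<bullet> (zs - z k \<omega>)" for \<omega>
  define V where "V \<omega> = (norm (z k \<omega> - w (k - 1) \<omega>))\<^sup>2" for \<omega>
  define R where "R \<omega> = (norm (z (Suc k) \<omega> - z k \<omega>))\<^sup>2" for \<omega>
  define D where "D \<omega> = \<Delta> k \<omega> \<bullet> (zs - z k \<omega>)" for \<omega>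
  define N where "N \<omega> = (norm (\<Delta> k \<omega>))\<^sup>2" for \<omega>
  note defs = Z'_def W'_def C'_def V'_def Z_def W_def C_def V_def R_def D_def N_def
  have int: "integrable M Z'" "integrable M W'" "integrable M C'" "integrable M V'" "integrable M Z"
    "integrable M W" "integrable M C" "integrable M V" "integrable M R" "integrable M D" "integrable M N"
    unfolding defs[abs_def]
    using square_integrable[OF zs] cross_integrable[OF zs] gap_integrable step_integrable
      noise_integrable(1)[OF k gap_integrable] noise_average(1)[OF k zs A] by auto
  have "I (\<lambda>\<omega>. Z' \<omega> + 2 * \<tau> * C' \<omega> + (1 - \<alpha>) * V' \<omega>) \<le> I (\<lambda>\<omega>. \<alpha> * Z \<omega> + (1 - \<alpha>) * W \<omega> + 2 * \<tau> * D \<omega>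
      + \<tau>\<^sup>2 / (\<alpha> * \<gamma>) * N \<omega> - (1 - \<gamma>) * \<alpha> * R \<omega>)"
  proof (rule I_mono)
    fix \<omega> assume "\<omega> \<in> space M"
    from forb_step_estimate[OF G_mono F zs \<tau>_pos \<alpha>(1) \<gamma>(1) z_step[OF k this]]
    show "Z' \<omega> + 2 * \<tau> * C' \<omega> + (1 - \<alpha>) * V' \<omega> \<le> \<alpha> * Z \<omega> + (1 - \<alpha>) * W \<omega> + 2 * \<tau> * D \<omega>
      + \<tau>\<^sup>2 / (\<alpha> * \<gamma>) * N \<omega> - (1 - \<gamma>) * \<alpha> * R \<omega>"
      unfolding defs .
  qed (use int in simp_all)
  then have step: "I Z' + 2 * \<tau> * I C' + (1 - \<alpha>) * I V' \<le>
      \<alpha> * I Z + (1 - \<alpha>) * I W + 2 * \<tau> * I D + \<tau>\<^sup>2 / (\<alpha> * \<gamma>) * I N - (1 - \<gamma>) * \<alpha> * I R"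
    using int by (simp add: I_add I_diff I_mult del: times_divide_eq_left)
  have "\<tau>\<^sup>2 / (\<alpha> * \<gamma>) * I N \<le> \<tau>\<^sup>2 / (\<alpha> * \<gamma>) * (L\<^sup>2 * I V)"
    using noise_integrable(2)[OF k gap_integrable A] \<alpha> \<gamma>
    unfolding I_def defs by (intro mult_left_mono) auto
  also have "\<dots> = (1 - \<alpha>) * \<gamma> * I V"
    unfolding mult.assoc[symmetric] \<tau>_L_sq ..
  finally have noise: "\<tau>\<^sup>2 / (\<alpha> * \<gamma>) * I N \<le> (1 - \<alpha>) * \<gamma> * I V" .
  have D: "I D = I C"
    using noise_average(2)[OF k zs A] by (simp add: I_def defs)
  have "q * (p * I Z' + (1 - p) * I W) = q * p * I Z' + (q - q * p) * I W" for q
    by (simp add: algebra_simps)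
  moreover have "I W' = p * I Z' + (1 - p) * I W"
    using coin_average[OF k zs A] by (simp add: I_def defs)
  ultimately have "(1 - \<alpha>) / p * I W' = (1 - \<alpha>) / p * p * I Z' + ((1 - \<alpha>) / p - (1 - \<alpha>) / p * p) * I W"
    by presburger
  then have W': "(1 - \<alpha>) / p * I W' = (1 - \<alpha>) * I Z' + ((1 - \<alpha>) / p - (1 - \<alpha>)) * I W"
    using p by simp
  have "\<Phi> F \<alpha> p \<tau> z w (Suc k) zs = (\<lambda>\<omega>. \<alpha> * Z' \<omega> + (1 - \<alpha>) / p * W' \<omega> + 2 * \<tau> * C' \<omega> + (1 - \<alpha>) * V' \<omega>)"
    by (simp add: fun_eq_iff \<Phi>_def defs)
  then have \<Phi>': "I (\<Phi> F \<alpha> p \<tau> z w (Suc k) zs) =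
      \<alpha> * I Z' + (1 - \<alpha>) / p * I W' + 2 * \<tau> * I C' + (1 - \<alpha>) * I V'"
    using int by (simp add: I_add I_mult del: times_divide_eq_left)
  have "\<Phi> F \<alpha> p \<tau> z w k zs = (\<lambda>\<omega>. \<alpha> * Z \<omega> + (1 - \<alpha>) / p * W \<omega> + 2 * \<tau> * C \<omega> + (1 - \<alpha>) * V \<omega>)"
    by (simp add: fun_eq_iff \<Phi>_def defs)
  then have \<Phi>: "I (\<Phi> F \<alpha> p \<tau> z w k zs) =
      \<alpha> * I Z + (1 - \<alpha>) / p * I W + 2 * \<tau> * I C + (1 - \<alpha>) * I V"
    using int by (simp add: I_add I_mult del: times_divide_eq_left)
  have "I (\<Phi> F \<alpha> p \<tau> z w (Suc k) zs) + (1 - \<gamma>) * ((1 - \<alpha>) * I V + \<alpha> * I R) \<le> I (\<Phi> F \<alpha> p \<tau> z w k zs)"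
    unfolding \<Phi>' \<Phi> W' using step noise unfolding D by (simp add: algebra_simps del: times_divide_eq_left)
  then show ?thesis
    by (simp add: I_def V_def R_def)
qed

lemma set_integral_sq_nonneg: "0 \<le> (\<integral>\<omega>\<in>A. (norm (f \<omega>))\<^sup>2 \<partial>M)"
  by (simp add: set_lebesgue_integral_def)

lemma \<Phi>_decreasing:
  assumes k: "1 \<le> k" and zs: "zs \<in> Sol F G" and A: "A \<in> sets (\<P> k)"
  shows "(\<integral>\<omega>\<in>A. \<Phi> F \<alpha> p \<tau> z w (Suc k) zs \<omega> \<partial>M) \<le> (\<integral>\<omega>\<in>A. \<Phi> F \<alpha> p \<tau> z w k zs \<omega> \<partial>M)"
proof -
  have "0 \<le> (1 - \<gamma>) * ((1 - \<alpha>) * (\<integral>\<omega>\<in>A. (norm (z k \<omega> - w (k - 1) \<omega>))\<^sup>2 \<partial>M)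
          + \<alpha> * (\<integral>\<omega>\<in>A. (norm (z (Suc k) \<omega> - z k \<omega>))\<^sup>2 \<partial>M))"
    using \<alpha> \<gamma> by (intro mult_nonneg_nonneg add_nonneg_nonneg set_integral_sq_nonneg) auto
  then show ?thesis
    using \<Phi>_drift[OF assms] by linarith
qed

lemma \<Phi>_cond_exp:
  assumes k: "1 \<le> k" and zs: "zs \<in> Sol F G"
  shows "AE \<omega> in M. real_cond_exp M (\<P> k) (\<Phi> F \<alpha> p \<tau> z w (Suc k) zs) \<omega> \<le> \<Phi> F \<alpha> p \<tau> z w k zs \<omega>"
proof -
  interpret P: finite_measure_subalgebra M "\<P> k"
    by unfold_locales (rule subalgebra_past[OF k])
  show ?thesis
    by (rule P.real_cond_exp_le_of_set_integral_le[OF \<Phi>_integrable[OF zs] \<Phi>_integrable[OF zs]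
          \<Phi>_measurable_past \<Phi>_decreasing[OF k zs]])
qed

section \<open>Almost sure convergence\<close>

lemma \<Phi>_convergent:
  assumes zs: "zs \<in> Sol F G"
  shows "AE \<omega> in M. convergent (\<lambda>n. \<Phi> F \<alpha> p \<tau> z w (Suc n) zs \<omega>)"
  by (rule nonneg_supermartingale_convergent[where \<F> = "\<lambda>n. \<P> (Suc n)"])
    (auto intro: subalgebra_past past_mono[THEN subsetD] \<Phi>_measurable_past \<Phi>_integrable \<Phi>_nonneg \<Phi>_decreasing zs)

text \<open>The drift inequality telescopes, and the expectation of \<open>\<Phi>\<close> stays nonnegative.\<close>

lemma residuals_summable:
  obtains K where "\<And>n. (\<Sum>i<n. expectation (\<lambda>\<omega>. (norm (z (Suc i) \<omega> - w i \<omega>))\<^sup>2)) \<le> K"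
    and "\<And>n. (\<Sum>i<n. expectation (\<lambda>\<omega>. (norm (z (Suc (Suc i)) \<omega> - z (Suc i) \<omega>))\<^sup>2)) \<le> K"
proof -
  obtain zs where zs: "zs \<in> Sol F G" using sol by blast
  define a where "a i = expectation (\<lambda>\<omega>. (norm (z (Suc i) \<omega> - w i \<omega>))\<^sup>2)" for i
  define b where "b i = expectation (\<lambda>\<omega>. (norm (z (Suc (Suc i)) \<omega> - z (Suc i) \<omega>))\<^sup>2)" for i
  define f where "f i = expectation (\<Phi> F \<alpha> p \<tau> z w (Suc i) zs)" for i
  \<comment> \<open>The smaller of the weights which the drift inequality puts on the two residuals.\<close>
  define \<kappa> where "\<kappa> = (1 - \<gamma>) * min (1 - \<alpha>) \<alpha>"
  have \<kappa>: "0 < \<kappa>"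
    using \<alpha> \<gamma> by (simp add: \<kappa>_def)
  have ab: "0 \<le> a i" "0 \<le> b i" for i
    by (simp_all add: a_def b_def)
  have f: "0 \<le> f i" for i
    by (simp add: f_def \<Phi>_nonneg)
  have step: "f (Suc i) + \<kappa> * (a i + b i) \<le> f i" for i
  proof -
    have "space M \<in> sets (\<P> (Suc i))"
      using sets.top[of "\<P> (Suc i)"] by simp
    from \<Phi>_drift[OF _ zs this]
    have "f (Suc i) + (1 - \<gamma>) * ((1 - \<alpha>) * a i + \<alpha> * b i) \<le> f i"
      by (simp add: f_def a_def b_def set_integral_space \<Phi>_integrable[OF zs] gap_integrable step_integrable)
    moreover have "\<kappa> * (a i + b i) \<le> (1 - \<gamma>) * ((1 - \<alpha>) * a i + \<alpha> * b i)"
      unfolding \<kappa>_def mult.assoc distrib_left using \<gamma> ab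
      by (intro mult_left_mono add_mono mult_right_mono) auto
    ultimately show ?thesis by linarith
  qed
  have sum: "\<kappa> * (\<Sum>i<n. a i + b i) \<le> f 0 - f n" for n
  proof (induction n)
    case (Suc n)
    then show ?case
      using step[of n] by (simp add: distrib_left)
  qed simp
  have bound: "(\<Sum>i<n. a i + b i) \<le> f 0 / \<kappa>" for n
    using sum[of n] f[of n] \<kappa> by (simp add: field_simps)
  show thesis
  proof (rule that[folded a_def b_def])
    fix n
    have "(\<Sum>i<n. a i) \<le> (\<Sum>i<n. a i + b i)" "(\<Sum>i<n. b i) \<le> (\<Sum>i<n. a i + b i)"
      using ab by (auto intro!: sum_mono)
    then show "(\<Sum>i<n. a i) \<le> f 0 / \<kappa>" "(\<Sum>i<n. b i) \<le> f 0 / \<kappa>"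
      using bound[of n] by linarith+
  qed
qed

lemma residuals_vanish:
  "AE \<omega> in M. (\<lambda>n. z (Suc n) \<omega> - w n \<omega>) \<longlonglongrightarrow> 0"
  "AE \<omega> in M. (\<lambda>n. z (Suc (Suc n)) \<omega> - z (Suc n) \<omega>) \<longlonglongrightarrow> 0"
  "AE \<omega> in M. (\<lambda>n. \<Delta> (Suc n) \<omega>) \<longlonglongrightarrow> 0"
proof -
  have null: "AE \<omega> in M. (\<lambda>n. f n \<omega>) \<longlonglongrightarrow> 0"
    if "\<And>n. integrable M (\<lambda>\<omega>. (norm (f n \<omega>))\<^sup>2)" "\<And>n. (\<Sum>i<n. expectation (\<lambda>\<omega>. (norm (f i \<omega>))\<^sup>2)) \<le> K"
    for f :: "nat \<Rightarrow> 'w \<Rightarrow> 'z" and K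
  proof -
    have "AE \<omega> in M. (\<lambda>n. (norm (f n \<omega>))\<^sup>2) \<longlonglongrightarrow> 0"
      using that by (intro AE_tendsto_zero_if_integral_sum_bounded) auto
    then show ?thesis
    proof eventually_elim
      case (elim \<omega>)
      then have "(\<lambda>n. sqrt ((norm (f n \<omega>))\<^sup>2)) \<longlonglongrightarrow> sqrt 0"
        by (rule tendsto_real_sqrt)
      then show ?case
        by (simp add: tendsto_norm_zero_iff)
    qed
  qed
  obtain K where K: "\<And>n. (\<Sum>i<n. expectation (\<lambda>\<omega>. (norm (z (Suc i) \<omega> - w i \<omega>))\<^sup>2)) \<le> K"
    "\<And>n. (\<Sum>i<n. expectation (\<lambda>\<omega>. (norm (z (Suc (Suc i)) \<omega> - z (Suc i) \<omega>))\<^sup>2)) \<le> K"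
    using residuals_summable by blast
  show "AE \<omega> in M. (\<lambda>n. z (Suc n) \<omega> - w n \<omega>) \<longlonglongrightarrow> 0"
    by (rule null[OF gap_integrable K(1)])
  show "AE \<omega> in M. (\<lambda>n. z (Suc (Suc n)) \<omega> - z (Suc n) \<omega>) \<longlonglongrightarrow> 0"
    by (rule null[OF step_integrable K(2)])
  show "AE \<omega> in M. (\<lambda>n. \<Delta> (Suc n) \<omega>) \<longlonglongrightarrow> 0"
  proof (rule null)
    show int: "integrable M (\<lambda>\<omega>. (norm (\<Delta> (Suc n) \<omega>))\<^sup>2)" for n
      by (rule noise_integrable(1)[OF _ gap_integrable]) simp
    have "expectation (\<lambda>\<omega>. (norm (\<Delta> (Suc i) \<omega>))\<^sup>2) \<le> L\<^sup>2 * expectation (\<lambda>\<omega>. (norm (z (Suc i) \<omega> - w i \<omega>))\<^sup>2)" for i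
    proof -
      have "space M \<in> sets (\<P> (Suc i))"
        using sets.top[of "\<P> (Suc i)"] by simp
      from noise_integrable(2)[OF _ gap_integrable this]
      show ?thesis
        using int[of i] by (simp add: set_integral_space gap_integrable)
    qed
    then have "(\<Sum>i<n. expectation (\<lambda>\<omega>. (norm (\<Delta> (Suc i) \<omega>))\<^sup>2)) \<le>
        L\<^sup>2 * (\<Sum>i<n. expectation (\<lambda>\<omega>. (norm (z (Suc i) \<omega> - w i \<omega>))\<^sup>2))" for n
      unfolding sum_distrib_left by (intro sum_mono)
    then show "(\<Sum>i<n. expectation (\<lambda>\<omega>. (norm (\<Delta> (Suc i) \<omega>))\<^sup>2)) \<le> L\<^sup>2 * K" for n
      using mult_left_mono[OF K(1)[of n], of "L\<^sup>2"] by (meson order_trans zero_le_power2)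
  qed
qed

text \<open>In the limit the cross term and the last term of \<open>\<Phi>\<close> vanish, since \<open>z\<^sub>k - w\<^sub>k\<^sub>-\<^sub>1\<close> tends to zero and
  \<open>z\<^sub>k\<close> is bounded; and \<open>w\<^sub>k\<close> may be replaced by \<open>z\<^sub>k\<close>, since both residuals vanish. What is left of
  \<open>\<Phi>\<close> is a positive multiple of the squared distance.\<close>

lemma distance_convergent:
  assumes conv: "convergent (\<lambda>n. \<Phi> F \<alpha> p \<tau> z w (Suc n) x \<omega>)"
    and gap: "(\<lambda>n. z (Suc n) \<omega> - w n \<omega>) \<longlonglongrightarrow> 0"
    and step: "(\<lambda>n. z (Suc (Suc n)) \<omega> - z (Suc n) \<omega>) \<longlonglongrightarrow> 0"
  shows "convergent (\<lambda>n. norm (z (Suc n) \<omega> - x))"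
proof -
  define a where "a n = norm (z (Suc n) \<omega> - x)" for n
  define \<phi> where "\<phi> n = \<Phi> F \<alpha> p \<tau> z w (Suc n) x \<omega>" for n
  define v where "v n = norm (z (Suc n) \<omega> - w n \<omega>)" for n
  define q where "q n = (F (z (Suc n) \<omega>) - F (w n \<omega>)) \<bullet> (x - z (Suc n) \<omega>)" for n
  define d where "d n = w (Suc n) \<omega> - z (Suc n) \<omega>" for n
  obtain B where B: "\<And>n. \<phi> n \<le> B"
    using convergent_imp_Bseq[OF conv] unfolding Bseq_def \<phi>_def real_norm_def by (meson abs_le_D1)
  have "(a n)\<^sup>2 \<le> B / ((1 - \<gamma>) * \<alpha>)" for n
  proof -
    have "(1 - \<gamma>) * \<alpha> * (a n)\<^sup>2 \<le> (1 - \<gamma>) * (\<alpha> * (a n)\<^sup>2 + (1 - \<alpha>) * (v n)\<^sup>2) + (1 - \<alpha>) / p * (norm (w (Suc n) \<omega> - x))\<^sup>2"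
      using \<alpha> \<gamma> p by (simp add: distrib_left)
    also have "\<dots> \<le> \<phi> n"
      using \<Phi>_lower_bound[of "Suc n" \<omega> x] by (simp add: a_def v_def \<phi>_def)
    finally have "(a n)\<^sup>2 * ((1 - \<gamma>) * \<alpha>) \<le> B"
      using B[of n] by (simp add: mult.commute)
    moreover have "0 < (1 - \<gamma>) * \<alpha>"
      using \<alpha> \<gamma> by simp
    ultimately show ?thesis
      by (simp only: pos_le_divide_eq)
  qed
  then have a_le: "a n \<le> sqrt (B / ((1 - \<gamma>) * \<alpha>))" for n
    by (rule real_le_rsqrt)
  define b where "b = sqrt (B / ((1 - \<gamma>) * \<alpha>))"
  have v: "v \<longlonglongrightarrow> 0"
    unfolding v_def[abs_def] by (rule tendsto_norm_zero[OF gap])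
  have q: "q \<longlonglongrightarrow> 0"
  proof (rule Lim_null_comparison)
    have "norm (q n) \<le> L * v n * b" for n
    proof -
      have "norm (q n) \<le> norm (F (z (Suc n) \<omega>) - F (w n \<omega>)) * norm (x - z (Suc n) \<omega>)"
        unfolding q_def real_norm_def by (rule Cauchy_Schwarz_ineq2)
      also have "\<dots> \<le> (L * v n) * b"
        using lipschitz a_le[of n] L
        by (intro mult_mono) (auto simp: v_def a_def b_def norm_minus_commute)
      finally show ?thesis .
    qed
    then show "\<forall>\<^sub>F n in sequentially. norm (q n) \<le> L * v n * b"
      by simp
    show "(\<lambda>n. L * v n * b) \<longlonglongrightarrow> 0"
      using tendsto_mult_left[OF tendsto_mult_right[OF v, of b], of L] by (simp add: mult.assoc)
  qed
  have "(\<lambda>n. (z (Suc (Suc n)) \<omega> - z (Suc n) \<omega>) - (z (Suc (Suc n)) \<omega> - w (Suc n) \<omega>)) \<longlonglongrightarrow> 0 - 0"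
    by (intro tendsto_diff step LIMSEQ_Suc[OF gap])
  then have d: "d \<longlonglongrightarrow> 0"
    unfolding d_def[abs_def] by simp
  have e: "(\<lambda>n. (norm (w (Suc n) \<omega> - x))\<^sup>2 - (a n)\<^sup>2) \<longlonglongrightarrow> 0"
  proof (rule Lim_null_comparison)
    have "norm ((norm (w (Suc n) \<omega> - x))\<^sup>2 - (a n)\<^sup>2) \<le> norm (d n) * (norm (d n) + 2 * b)" for n
    proof -
      have "(norm (w (Suc n) \<omega> - x))\<^sup>2 - (a n)\<^sup>2 = d n \<bullet> (d n + 2 *\<^sub>R (z (Suc n) \<omega> - x))"
        unfolding a_def d_def power2_norm_eq_inner
        by (simp add: inner_diff_left inner_diff_right inner_add_right inner_commute algebra_simps)
      then have "norm ((norm (w (Suc n) \<omega> - x))\<^sup>2 - (a n)\<^sup>2) \<le> norm (d n) * norm (d n + 2 *\<^sub>R (z (Suc n) \<omega> - x))"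
        using Cauchy_Schwarz_ineq2 by simp
      also have "\<dots> \<le> norm (d n) * (norm (d n) + 2 * b)"
        using a_le[of n] norm_triangle_ineq[of "d n" "2 *\<^sub>R (z (Suc n) \<omega> - x)"]
        by (intro mult_left_mono) (auto simp: a_def b_def)
      finally show ?thesis .
    qed
    then show "\<forall>\<^sub>F n in sequentially. norm ((norm (w (Suc n) \<omega> - x))\<^sup>2 - (a n)\<^sup>2) \<le> norm (d n) * (norm (d n) + 2 * b)"
      by simp
    have "(\<lambda>n. norm (d n) * (norm (d n) + 2 * b)) \<longlonglongrightarrow> 0 * (0 + 2 * b)"
      by (intro tendsto_mult tendsto_add tendsto_norm_zero d tendsto_const)
    then show "(\<lambda>n. norm (d n) * (norm (d n) + 2 * b)) \<longlonglongrightarrow> 0"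
      by simp
  qed
  obtain l where l: "\<phi> \<longlonglongrightarrow> l"
    using conv unfolding \<phi>_def[abs_def] convergent_def by blast
  define \<beta> where "\<beta> = (1 - \<alpha>) / p"
  have \<beta>: "0 < \<alpha> + \<beta>"
    using \<alpha> p by (simp add: \<beta>_def add_pos_pos)
  have "(\<alpha> + \<beta>) * (a n)\<^sup>2 = \<phi> n - \<beta> * ((norm (w (Suc n) \<omega> - x))\<^sup>2 - (a n)\<^sup>2) - 2 * \<tau> * q n - (1 - \<alpha>) * (v n)\<^sup>2" for n
    unfolding \<phi>_def \<Phi>_def \<beta>_def[symmetric] by (simp add: a_def q_def v_def algebra_simps)
  then have "(a n)\<^sup>2 = (\<phi> n - \<beta> * ((norm (w (Suc n) \<omega> - x))\<^sup>2 - (a n)\<^sup>2) - 2 * \<tau> * q n - (1 - \<alpha>) * (v n)\<^sup>2) / (\<alpha> + \<beta>)" for n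
    using \<beta> by (simp add: nonzero_eq_divide_eq mult.commute)
  moreover have "(\<lambda>n. (\<phi> n - \<beta> * ((norm (w (Suc n) \<omega> - x))\<^sup>2 - (a n)\<^sup>2) - 2 * \<tau> * q n - (1 - \<alpha>) * (v n)\<^sup>2) / (\<alpha> + \<beta>))
      \<longlonglongrightarrow> (l - \<beta> * 0 - 2 * \<tau> * 0 - (1 - \<alpha>) * 0\<^sup>2) / (\<alpha> + \<beta>)"
    using \<beta> by (intro tendsto_intros l e q v) auto
  ultimately have "(\<lambda>n. (a n)\<^sup>2) \<longlonglongrightarrow> l / (\<alpha> + \<beta>)"
    by simp
  then have "(\<lambda>n. sqrt ((a n)\<^sup>2)) \<longlonglongrightarrow> sqrt (l / (\<alpha> + \<beta>))"
    by (rule tendsto_real_sqrt)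
  then show ?thesis
    unfolding convergent_def by (auto simp: a_def)
qed

text \<open>Solving the resolvent step for the element of \<open>G (z\<^sub>k\<^sub>+\<^sub>1)\<close> that it contains, one finds that these
  elements tend to \<open>- F l\<close> along the subsequence.\<close>

lemma cluster_point_Sol:
  assumes \<omega>: "\<omega> \<in> space M"
    and gap: "(\<lambda>n. z (Suc n) \<omega> - w n \<omega>) \<longlonglongrightarrow> 0"
    and step: "(\<lambda>n. z (Suc (Suc n)) \<omega> - z (Suc n) \<omega>) \<longlonglongrightarrow> 0"
    and noise: "(\<lambda>n. \<Delta> (Suc n) \<omega>) \<longlonglongrightarrow> 0"
    and r: "strict_mono r" and l: "(\<lambda>n. z (Suc (r n)) \<omega>) \<longlonglongrightarrow> l"
  shows "l \<in> Sol F G"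
proof -
  have sub: "(\<lambda>n. f (r n)) \<longlonglongrightarrow> x" if "f \<longlonglongrightarrow> x" for f :: "nat \<Rightarrow> 'z" and x
    using LIMSEQ_subseq_LIMSEQ[OF that r] by (simp add: o_def)
  define y where "y n = z (Suc (Suc (r n))) \<omega>" for n
  define v where "v n = w (Suc (r n)) \<omega>" for n
  define x where "x n = z (Suc (r n)) \<omega>" for n
  have x: "x \<longlonglongrightarrow> l"
    using l by (simp add: x_def[abs_def])
  have "(\<lambda>n. (y n - x n) + x n) \<longlonglongrightarrow> 0 + l"
    unfolding y_def x_def by (intro tendsto_add sub[OF step] l)
  then have y: "y \<longlonglongrightarrow> l"
    by simp
  have "(\<lambda>n. y n - (y n - v n)) \<longlonglongrightarrow> l - 0"
    by (intro tendsto_diff y) (use sub[OF LIMSEQ_Suc[OF gap]] in \<open>simp add: y_def v_def\<close>)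
  then have v: "v \<longlonglongrightarrow> l"
    by simp
  define g where "g n = (1 / \<tau>) *\<^sub>R (\<alpha> *\<^sub>R x n + (1 - \<alpha>) *\<^sub>R v n - y n) - F (v n) - \<Delta> (Suc (r n)) \<omega>" for n
  have g_mem: "g n \<in> G (y n)" for n
  proof -
    obtain h where h: "h \<in> G (y n)"
      and eq: "\<alpha> *\<^sub>R x n + (1 - \<alpha>) *\<^sub>R v n - \<tau> *\<^sub>R F (v n) - \<tau> *\<^sub>R \<Delta> (Suc (r n)) \<omega> = y n + \<tau> *\<^sub>R h"
      using z_step[OF _ \<omega>, of "Suc (r n)"]
      unfolding resolvent_op_scale_iff y_def x_def v_def by auto
    have "\<alpha> *\<^sub>R x n + (1 - \<alpha>) *\<^sub>R v n - y n = \<tau> *\<^sub>R (h + F (v n) + \<Delta> (Suc (r n)) \<omega>)"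
      using eq by (simp add: algebra_simps)
    then have "g n = h"
      using \<tau>_pos by (simp add: g_def)
    with h show ?thesis by simp
  qed
  have "(\<lambda>n. F (v n)) \<longlonglongrightarrow> F l"
    using F_cont v by (auto simp: continuous_on_def intro: tendsto_compose continuous_on_tendsto_compose)
  then have "g \<longlonglongrightarrow> (1 / \<tau>) *\<^sub>R (\<alpha> *\<^sub>R l + (1 - \<alpha>) *\<^sub>R l - l) - F l - 0"
    unfolding g_def[abs_def] by (intro tendsto_intros x y v sub[OF noise])
  then have "g \<longlonglongrightarrow> - F l"
    by (simp add: algebra_simps)
  from maximally_monotone_closed_graph[OF G g_mem this y] show ?thesis
    by (simp add: Sol_iff)
qed

lemma converges_almost_surely: "AE \<omega> in M. \<exists>zs\<in>Sol F G. (\<lambda>k. z k \<omega>) \<longlonglongrightarrow> zs"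
proof -
  obtain D where D: "countable D" "D \<subseteq> Sol F G" "Sol F G \<subseteq> closure D"
    by (rule separable)
  have "AE \<omega> in M. \<forall>d\<in>D. convergent (\<lambda>n. \<Phi> F \<alpha> p \<tau> z w (Suc n) d \<omega>)"
    using D \<Phi>_convergent by (subst AE_ball_countable) auto
  then show ?thesis
    using residuals_vanish AE_space
  proof eventually_elim
    case (elim \<omega>)
    have "\<exists>l\<in>Sol F G. (\<lambda>n. z (Suc n) \<omega>) \<longlonglongrightarrow> l"
    proof (rule opial_convergence[OF D(2,3) sol])
      show "convergent (\<lambda>n. norm (z (Suc n) \<omega> - d))" if "d \<in> D" for d
        using distance_convergent elim that by blast
      show "l \<in> Sol F G" if "strict_mono r" "((\<lambda>n. z (Suc n) \<omega>) \<circ> r) \<longlonglongrightarrow> l" for l r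
        using cluster_point_Sol[OF elim(5,2,3,4) that(1)] that(2) by (simp add: o_def)
    qed
    then show ?case
      using LIMSEQ_imp_Suc[of "\<lambda>k. z k \<omega>"] by blast
  qed
qed

end

theorem theorem4p5:
  fixes F :: "'z::euclidean_space \<Rightarrow> 'z"
    and G :: "'z \<Rightarrow> 'z set"
    and Q :: "'x measure"
    and Fo :: "'x \<Rightarrow> 'z \<Rightarrow> 'z"
    and M :: "'w measure"
    and \<xi> :: "nat \<Rightarrow> 'w \<Rightarrow> 'x"
    and c :: "nat \<Rightarrow> 'w \<Rightarrow> bool"
    and z w :: "nat \<Rightarrow> 'w \<Rightarrow> 'z"
    and z\<^sub>0 :: 'z
    and L \<alpha> p \<gamma> \<tau> :: real
  assumes "maximally_monotone G"
    and "maximally_monotone (\<lambda>x. {F x})"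
    and "Sol F G \<noteq> {}"
    and "L > 0"
    and "stochastic_oracle Q Fo F L"
    and "0 < \<alpha>" "\<alpha> < 1"
    and "0 < p" "p \<le> 1"
    and "0 < \<gamma>" "\<gamma> < 1"
    and "\<tau> = sqrt (\<alpha> * (1 - \<alpha>)) / L * \<gamma>"
    and "prob_space M"
    and "independent_draws M Q p \<xi> c"
    and "forb_vr M F G Fo \<alpha> \<tau> z\<^sub>0 \<xi> c z w"
  shows "(\<forall>zs\<in>Sol F G. \<forall>k\<ge>1.
            (\<forall>\<omega>\<in>space M. 0 \<le> \<Phi> F \<alpha> p \<tau> z w k zs \<omega>) \<and>
            integrable M (\<Phi> F \<alpha> p \<tau> z w (k + 1) zs) \<and>
            (AE \<omega> in M. real_cond_exp M (past M Q \<xi> w k) (\<Phi> F \<alpha> p \<tau> z w (k + 1) zs) \<omega>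
                          \<le> \<Phi> F \<alpha> p \<tau> z w k zs \<omega>)) \<and>
         ((\<forall>s\<in>space Q. continuous_on UNIV (Fo s)) \<longrightarrow>
            (AE \<omega> in M. \<exists>zs\<in>Sol F G. (\<lambda>k. z k \<omega>) \<longlonglongrightarrow> zs))"
proof -
  interpret forb_run M F G Q Fo \<xi> c z w z\<^sub>0 L \<alpha> p \<gamma> \<tau>
    using assms unfolding forb_run_def forb_run_axioms_def maximally_monotone_def by blast
  show ?thesis
    using \<Phi>_nonneg \<Phi>_integrable \<Phi>_cond_exp converges_almost_surely by auto
qed

end
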